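(* Let $V,W$ be $\mathcal U_q$-modules, let $v\in V$ and $w\in W$ be weight vectors, and let $\lambda\in\mathbb{C}$ be such that $\lambda-\mathrm{wt}(v)\notin\mathbb{Z}_{\ge0}$ and $\lambda-\mathrm{wt}(v)-\mathrm{wt}(w)\notin\mathbb{Z}_{\ge0}$. Then the fusion matrix $J_{W,V}(\lambda)$, i.e. the map determined by $$(\Phi_{q,\lambda-\mathrm{wt}(v)}^{w}\otimes\mathrm{id})\circ\Phi_{q,\lambda}^{v}=\Phi_{q,\lambda}^{J_{W,V}(\lambda)(w\otimes v)},$$ can be written as $$J_{W,V}(\lambda)(w\otimes v)=\sum_{l=0}^\infty\frac{q^{-\frac l2(\lambda+1)}}{[l]_q!}\,f^lq^{lh/4}\cdot w\;\otimes\;e^l\,\frac{q^{lh/4}}{([-\lambda+h]_q)_l}\cdot v .$$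
   Context: Fix $0<q<1$, $q^z:=\exp(z\ln q)$. Notation: $[a]_q:=\frac{q^{a/2}-q^{-a/2}}{q^{1/2}-q^{-1/2}}$, $[k]_q!:=\prod_{i=1}^k[i]_q$, $([a]_q)_k:=\prod_{i=0}^{k-1}[a+i]_q$. $\mathcal U_q=\mathcal U_q(sl(2,\mathbb{C}))$: a $\mathcal U_q$-module is a complex vector space $V$ with linear operators $e,f,h$ such that $V=\bigoplus_\lambda V[\lambda]$, $V[\lambda]=\{v:hv=\lambda v\}$, $eV[\lambda]\subset V[\lambda+2]$, $fV[\lambda]\subset V[\lambda-2]$, $ef-fe$ acts on $V[\lambda]$ as $[\lambda]_q$, and the real parts of the occurring weights are bounded above. A nonzero $v\in V[\lambda]$ is a weight vector, $\mathrm{wt}(v)=\lambda$. Functions of $h$ (such as $q^{ch}$ or $1/([-\lambda+h]_q)_l$) act on $V[\nu]$ by substituting $\nu$ for $h$; products of operators act right to left. On tensor products, $\mathcal U_q$ acts by $\Delta(h)=h\otimes1+1\otimes h$, $\Delta(e)=e\otimes q^{h/4}+q^{-h/4}\otimes e$, $\Delta(f)=f\otimes q^{h/4}+q^{-h/4}\otimes f$. An intertwining map is a linear map commuting with $e,f,h$. The Verma module $M_{q,\lambda}$ ($\lambda\in\mathbb{C}$) has basis $f^k\cdot x_\lambda$ ($k\in\mathbb{Z}_{\ge0}$), with $h f^kx_\lambda=(\lambda-2k)f^kx_\lambda$ and $e f^kx_\lambda=[k]_q[\lambda-k+1]_qf^{k-1}x_\lambda$ (so $ex_\lambda=0$). Intertwining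 map: for a $\mathcal U_q$-module $U$, $\lambda,\mu\in\mathbb{C}$ with $\mu\notin\mathbb{Z}_{\ge0}$ and $0\ne u\in U[\lambda-\mu]$, $\Phi_{q,\lambda}^u:M_{q,\lambda}\to M_{q,\mu}\otimes U$ is the unique intertwining map such that $\Phi_{q,\lambda}^u(x_\lambda)=\sum_{k\ge0}f^k\cdot x_\mu\otimes u_k$ with $u_0=u$. The composition $M_{q,\lambda}\to M_{q,\lambda-\mathrm{wt}(v)}\otimes V\to M_{q,\lambda-\mathrm{wt}(v)-\mathrm{wt}(w)}\otimes W\otimes V$ of $\Phi_{q,\lambda}^v$ and $\Phi^w_{q,\lambda-\mathrm{wt}(v)}\otimes\mathrm{id}$ is intertwining, hence of the form $\Phi_{q,\lambda}^u$ for some $u\in(W\otimes V)[\mathrm{wt}(v)+\mathrm{wt}(w)]$; the fusion matrix $J_{W,V}(\lambda)$ is the linear extension of the map $w\otimes v\mapsto u$.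
   Formalization: For non-real values, λ−wt(v) and λ−wt(v)−wt(w) must avoid Z≥0 + (2πi/ln q)Z, not only Z≥0: there some [μ−k]_q vanishes, so the intertwining map may not exist or be unique and the formula may have a zero denominator. *)

theory Defs
  imports Complex_Main "HOL-Library.Poly_Mapping"
begin

section \<open>Complex vector spaces\<close>

class complex_vector = ab_group_add +
  fixes scaleC :: "complex \<Rightarrow> 'a \<Rightarrow> 'a"  (infixr "*\<^sub>C" 75)
  assumes scaleC_add_right: "a *\<^sub>C (x + y) = a *\<^sub>C x + a *\<^sub>C y"
    and scaleC_add_left: "(a + b) *\<^sub>C x = a *\<^sub>C x + b *\<^sub>C x"
    and scaleC_scaleC: "a *\<^sub>C (b *\<^sub>C x) = (a * b) *\<^sub>C x"
    and scaleC_one: "1 *\<^sub>C x = x"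

global_interpretation cvec: vector_space "scaleC :: complex \<Rightarrow> 'a \<Rightarrow> 'a::complex_vector"
  by unfold_locales
    (simp_all add: scaleC_add_right scaleC_add_left scaleC_scaleC scaleC_one)

abbreviation clinear :: "('a::complex_vector \<Rightarrow> 'b::complex_vector) \<Rightarrow> bool"
  where "clinear \<equiv> Vector_Spaces.linear scaleC scaleC"

instantiation complex :: complex_vector
begin
definition scaleC_complex :: "complex \<Rightarrow> complex \<Rightarrow> complex"
  where "scaleC_complex = (*)"
instance
  by standard (simp_all add: scaleC_complex_def algebra_simps)
end

instantiation poly_mapping :: (type, complex_vector) complex_vector
begin
definition scaleC_poly_mapping :: "complex \<Rightarrow> ('a \<Rightarrow>\<^sub>0 'b) \<Rightarrow> 'a \<Rightarrow>\<^sub>0 'b"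
  where "scaleC_poly_mapping c = Poly_Mapping.map (scaleC c)"

lemma lookup_scaleC: "Poly_Mapping.lookup (c *\<^sub>C p) k = c *\<^sub>C Poly_Mapping.lookup p k"
  for p :: "'a \<Rightarrow>\<^sub>0 'b"
  by (simp add: scaleC_poly_mapping_def Poly_Mapping.map.rep_eq when_def)

instance
  by standard
    (rule poly_mapping_eqI;
      simp add: lookup_scaleC lookup_add scaleC_add_right scaleC_add_left scaleC_scaleC scaleC_one)+
end


section \<open>Tensor products\<close>

text \<open>The algebraic tensor product over the complex numbers: the free vector space on pairs
  modulo the bilinearity relations.\<close>

definition tensor_relations :: "('a::complex_vector \<times> 'b::complex_vector \<Rightarrow>\<^sub>0 complex) set"
  where "tensor_relations =
     {Poly_Mapping.single (a + a', b) 1 - Poly_Mapping.single (a, b) 1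
        - Poly_Mapping.single (a', b) 1 | a a' b. True}
   \<union> {Poly_Mapping.single (a, b + b') 1 - Poly_Mapping.single (a, b) 1
        - Poly_Mapping.single (a, b') 1 | a b b'. True}
   \<union> {Poly_Mapping.single (c *\<^sub>C a, b) 1 - c *\<^sub>C Poly_Mapping.single (a, b) 1 | c a b. True}
   \<union> {Poly_Mapping.single (a, c *\<^sub>C b) 1 - c *\<^sub>C Poly_Mapping.single (a, b) 1 | c a b. True}"

definition tensor_eq ::
    "('a::complex_vector \<times> 'b::complex_vector \<Rightarrow>\<^sub>0 complex) \<Rightarrow> ('a \<times> 'b \<Rightarrow>\<^sub>0 complex) \<Rightarrow> bool"
  where "tensor_eq x y \<longleftrightarrow> x - y \<in> cvec.span tensor_relations"

lemma equivp_tensor_eq: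
  "equivp (tensor_eq :: ('a::complex_vector \<times> 'b::complex_vector \<Rightarrow>\<^sub>0 complex) \<Rightarrow> _)"
proof (rule equivpI)
  show "reflp (tensor_eq :: ('a \<times> 'b \<Rightarrow>\<^sub>0 complex) \<Rightarrow> _)"
    by (simp add: reflp_def tensor_eq_def cvec.span_zero)
  show "symp (tensor_eq :: ('a \<times> 'b \<Rightarrow>\<^sub>0 complex) \<Rightarrow> _)"
    unfolding symp_def tensor_eq_def using cvec.span_neg by fastforce
  show "transp (tensor_eq :: ('a \<times> 'b \<Rightarrow>\<^sub>0 complex) \<Rightarrow> _)"
  proof (rule transpI)
    fix x y z :: "'a \<times> 'b \<Rightarrow>\<^sub>0 complex"
    assume "tensor_eq x y" "tensor_eq y z"
    then have "(x - y) + (y - z) \<in> cvec.span tensor_relations"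
      unfolding tensor_eq_def by (rule cvec.span_add)
    then show "tensor_eq x z"
      by (simp add: tensor_eq_def)
  qed
qed

lemma tensor_eqI: "x = y \<Longrightarrow> tensor_eq x y"
  by (simp add: tensor_eq_def cvec.span_zero)

quotient_type (overloaded) ('a, 'b) tensor =
    "'a::complex_vector \<times> 'b::complex_vector \<Rightarrow>\<^sub>0 complex" / tensor_eq
  by (rule equivp_tensor_eq)

instantiation tensor :: (complex_vector, complex_vector) complex_vector
begin

lift_definition zero_tensor :: "('a, 'b) tensor" is 0 .

lift_definition plus_tensor :: "('a, 'b) tensor \<Rightarrow> ('a, 'b) tensor \<Rightarrow> ('a, 'b) tensor" is "(+)"
proof -
  fix x x' y y' :: "'a \<times> 'b \<Rightarrow>\<^sub>0 complex"
  assume "tensor_eq x x'" "tensor_eq y y'"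
  moreover have "x + y - (x' + y') = (x - x') + (y - y')" by simp
  ultimately show "tensor_eq (x + y) (x' + y')"
    unfolding tensor_eq_def by (metis cvec.span_add)
qed

lift_definition uminus_tensor :: "('a, 'b) tensor \<Rightarrow> ('a, 'b) tensor" is uminus
proof -
  fix x x' :: "'a \<times> 'b \<Rightarrow>\<^sub>0 complex"
  assume "tensor_eq x x'"
  moreover have "- x - (- x') = - (x - x')" by simp
  ultimately show "tensor_eq (- x) (- x')"
    unfolding tensor_eq_def by (metis cvec.span_neg)
qed

lift_definition minus_tensor :: "('a, 'b) tensor \<Rightarrow> ('a, 'b) tensor \<Rightarrow> ('a, 'b) tensor" is "(-)"
proof -
  fix x x' y y' :: "'a \<times> 'b \<Rightarrow>\<^sub>0 complex"
  assume "tensor_eq x x'" "tensor_eq y y'"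
  moreover have "x - y - (x' - y') = (x - x') - (y - y')" by simp
  ultimately show "tensor_eq (x - y) (x' - y')"
    unfolding tensor_eq_def by (metis cvec.span_diff)
qed

lift_definition scaleC_tensor :: "complex \<Rightarrow> ('a, 'b) tensor \<Rightarrow> ('a, 'b) tensor" is scaleC
  unfolding tensor_eq_def by (metis cvec.span_scale cvec.scale_right_diff_distrib)

instance
  by standard
    (transfer; rule tensor_eqI;
      simp add: scaleC_add_right scaleC_add_left scaleC_scaleC scaleC_one)+

end

lift_definition tens :: "'a::complex_vector \<Rightarrow> 'b::complex_vector \<Rightarrow> ('a, 'b) tensor"
    (infixr "\<otimes>" 70)
  is "\<lambda>a b. Poly_Mapping.single (a, b) 1" .


definition tensor_map ::
    "('a::complex_vector \<Rightarrow> 'c::complex_vector) \<Rightarrow> ('b::complex_vector \<Rightarrow> 'd::complex_vector)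
     \<Rightarrow> ('a, 'b) tensor \<Rightarrow> ('c, 'd) tensor"
  where "tensor_map S T = (THE F. clinear F \<and> (\<forall>a b. F (a \<otimes> b) = S a \<otimes> T b))"

definition tensor_assoc ::
    "(('a::complex_vector, 'b::complex_vector) tensor, 'c::complex_vector) tensor
     \<Rightarrow> ('a, ('b, 'c) tensor) tensor"
  where "tensor_assoc = (THE F. clinear F \<and> (\<forall>a b c. F ((a \<otimes> b) \<otimes> c) = a \<otimes> (b \<otimes> c)))"


section \<open>Quantum numbers\<close>

definition qpow :: "real \<Rightarrow> complex \<Rightarrow> complex"
  where "qpow q z = exp (z * of_real (ln q))"

definition qnum :: "real \<Rightarrow> complex \<Rightarrow> complex"
  where "qnum q a = (qpow q (a / 2) - qpow q (- a / 2)) / (qpow q (1 / 2) - qpow q (- 1 / 2))"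

definition qfact :: "real \<Rightarrow> nat \<Rightarrow> complex"
  where "qfact q k = (\<Prod>i = 1..k. qnum q (of_nat i))"

definition qpoch :: "real \<Rightarrow> complex \<Rightarrow> nat \<Rightarrow> complex"
  where "qpoch q a k = (\<Prod>i<k. qnum q (a + of_nat i))"

text \<open>The condition ``\<open>\<mu>\<close> is not a nonnegative integer'', for complex \<open>\<mu>\<close>, modulo the period
  \<open>2 * pi * \<i> / ln q\<close> of \<open>qpow q\<close>; equivalently, \<open>qnum q (\<mu> - k) \<noteq> 0\<close> for all natural numbers
  \<open>k\<close>.  At the excluded non-real \<open>\<mu>\<close> the Verma module of highest weight \<open>\<mu>\<close> is reducible too,
  and the maps \<open>Phi\<close> into it need not exist or be unique.  For real \<open>\<mu>\<close> the period plays no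
  role.\<close>

definition generic :: "real \<Rightarrow> complex \<Rightarrow> bool"
  where "generic q \<mu> \<longleftrightarrow>
    \<not> (\<exists>(k::nat) (m::int). \<mu> = of_nat k + of_int m * (2 * of_real pi * \<i> / of_real (ln q)))"


section \<open>Modules\<close>

record 'v uq_ops =
  opE :: "'v \<Rightarrow> 'v"
  opF :: "'v \<Rightarrow> 'v"
  opH :: "'v \<Rightarrow> 'v"

definition weight_space :: "('v::complex_vector) uq_ops \<Rightarrow> complex \<Rightarrow> 'v set"
  where "weight_space V \<nu> = {v. opH V v = \<nu> *\<^sub>C v}"

definition uq_module :: "real \<Rightarrow> ('v::complex_vector) uq_ops \<Rightarrow> bool"
  where "uq_module q V \<longleftrightarrow>
     clinear (opE V) \<and> clinear (opF V) \<and> clinear (opH V)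
   \<and> (\<forall>v. \<exists>!d :: complex \<Rightarrow>\<^sub>0 'v. (\<forall>\<nu>. Poly_Mapping.lookup d \<nu> \<in> weight_space V \<nu>)
          \<and> v = (\<Sum>\<nu>\<in>Poly_Mapping.keys d. Poly_Mapping.lookup d \<nu>))
   \<and> (\<forall>\<nu>. opE V ` weight_space V \<nu> \<subseteq> weight_space V (\<nu> + 2))
   \<and> (\<forall>\<nu>. opF V ` weight_space V \<nu> \<subseteq> weight_space V (\<nu> - 2))
   \<and> (\<forall>\<nu>. \<forall>v\<in>weight_space V \<nu>. opE V (opF V v) - opF V (opE V v) = qnum q \<nu> *\<^sub>C v)
   \<and> (\<exists>B. \<forall>\<nu>. weight_space V \<nu> \<noteq> {0} \<longrightarrow> Re \<nu> \<le> B)"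

definition weight_vector :: "('v::complex_vector) uq_ops \<Rightarrow> 'v \<Rightarrow> bool"
  where "weight_vector V v \<longleftrightarrow> v \<noteq> 0 \<and> (\<exists>\<nu>. v \<in> weight_space V \<nu>)"

definition wt :: "('v::complex_vector) uq_ops \<Rightarrow> 'v \<Rightarrow> complex"
  where "wt V v = (THE \<nu>. v \<in> weight_space V \<nu>)"

text \<open>\<open>fun_h V g\<close> is the operator \<open>g(h)\<close>, acting on each weight space by substituting the weight
  for \<open>h\<close>.\<close>

definition fun_h :: "('v::complex_vector) uq_ops \<Rightarrow> (complex \<Rightarrow> complex) \<Rightarrow> 'v \<Rightarrow> 'v"
  where "fun_h V g = (THE T. clinear T \<and> (\<forall>\<nu>. \<forall>v\<in>weight_space V \<nu>. T v = g \<nu> *\<^sub>C v))"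

definition tensor_module ::
    "real \<Rightarrow> ('v::complex_vector) uq_ops \<Rightarrow> ('w::complex_vector) uq_ops \<Rightarrow> ('v, 'w) tensor uq_ops"
  where "tensor_module q V W =
   \<lparr> opE = (\<lambda>t. tensor_map (opE V) (fun_h W (\<lambda>z. qpow q (z / 4))) t
             + tensor_map (fun_h V (\<lambda>z. qpow q (- z / 4))) (opE W) t),
     opF = (\<lambda>t. tensor_map (opF V) (fun_h W (\<lambda>z. qpow q (z / 4))) t
             + tensor_map (fun_h V (\<lambda>z. qpow q (- z / 4))) (opF W) t),
     opH = (\<lambda>t. tensor_map (opH V) id t + tensor_map id (opH W) t) \<rparr>"

definition intertwining ::
    "('v::complex_vector) uq_ops \<Rightarrow> ('w::complex_vector) uq_ops \<Rightarrow> ('v \<Rightarrow> 'w) \<Rightarrow> bool"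
  where "intertwining V W T \<longleftrightarrow> clinear T
    \<and> (\<forall>x. T (opE V x) = opE W (T x))
    \<and> (\<forall>x. T (opF V x) = opF W (T x))
    \<and> (\<forall>x. T (opH V x) = opH W (T x))"


section \<open>Verma modules and intertwining maps\<close>

text \<open>All Verma modules live on the space with basis \<open>fx k\<close>, where \<open>fx k\<close> stands for
  \<open>f ^ k \<cdot> x\<close>; only the action depends on the highest weight.  In
  \<open>opE\<close> the coefficient for \<open>k = 0\<close> vanishes, so the truncated \<open>k - 1\<close> does no harm.\<close>

type_synonym verma_space = "nat \<Rightarrow>\<^sub>0 complex"

definition fx :: "nat \<Rightarrow> verma_space"
  where "fx k = Poly_Mapping.single k 1"

definition extend_linear :: "(nat \<Rightarrow> verma_space) \<Rightarrow> verma_space \<Rightarrow> verma_space"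
  where "extend_linear g p = (\<Sum>k\<in>Poly_Mapping.keys p. Poly_Mapping.lookup p k *\<^sub>C g k)"

definition verma :: "real \<Rightarrow> complex \<Rightarrow> verma_space uq_ops"
  where "verma q \<Lambda> =
   \<lparr> opE = extend_linear
       (\<lambda>k. (qnum q (of_nat k) * qnum q (\<Lambda> - of_nat k + 1)) *\<^sub>C fx (k - 1)),
     opF = extend_linear (\<lambda>k. fx (Suc k)),
     opH = extend_linear (\<lambda>k. (\<Lambda> - 2 * of_nat k) *\<^sub>C fx k) \<rparr>"

definition has_leading_vector :: "(verma_space, 'u::complex_vector) tensor \<Rightarrow> 'u \<Rightarrow> bool"
  where "has_leading_vector t u \<longleftrightarrow> (\<exists>uk :: nat \<Rightarrow>\<^sub>0 'u.
     t = (\<Sum>k\<in>Poly_Mapping.keys uk. fx k \<otimes> Poly_Mapping.lookup uk k)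
     \<and> Poly_Mapping.lookup uk 0 = u)"

text \<open>\<open>Phi q U \<Lambda> u\<close> maps the Verma module of highest weight \<open>\<Lambda>\<close> to the tensor product of the
  Verma module of highest weight \<open>\<Lambda> - wt U u\<close> with \<open>U\<close>.\<close>

definition Phi :: "real \<Rightarrow> ('u::complex_vector) uq_ops \<Rightarrow> complex \<Rightarrow> 'u
    \<Rightarrow> verma_space \<Rightarrow> (verma_space, 'u) tensor"
  where "Phi q U \<Lambda> u =
    (THE \<Phi>. intertwining (verma q \<Lambda>) (tensor_module q (verma q (\<Lambda> - wt U u)) U) \<Phi>
           \<and> has_leading_vector (\<Phi> (fx 0)) u)"


section \<open>The fusion matrix\<close>

definition fusion_vector :: "real \<Rightarrow> ('w::complex_vector) uq_ops \<Rightarrow> ('v::complex_vector) uq_ops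
    \<Rightarrow> complex \<Rightarrow> 'w \<Rightarrow> 'v \<Rightarrow> ('w, 'v) tensor"
  where "fusion_vector q W V \<Lambda> w v =
    (THE u. u \<noteq> 0 \<and> u \<in> weight_space (tensor_module q W V) (wt V v + wt W w)
          \<and> tensor_assoc \<circ> tensor_map (Phi q W (\<Lambda> - wt V v) w) id \<circ> Phi q V \<Lambda> v
              = Phi q (tensor_module q W V) \<Lambda> u)"

text \<open>The linear extension is determined on the span of the vectors \<open>w \<otimes> v\<close> to which the
  construction of \<open>fusion_vector\<close> applies; it is an arbitrary linear map on a complement.\<close>

definition fusion_matrix :: "real \<Rightarrow> ('w::complex_vector) uq_ops \<Rightarrow> ('v::complex_vector) uq_ops
    \<Rightarrow> complex \<Rightarrow> ('w, 'v) tensor \<Rightarrow> ('w, 'v) tensor"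
  where "fusion_matrix q W V \<Lambda> = (SOME J. clinear J
    \<and> (\<forall>w v. weight_vector W w \<longrightarrow> weight_vector V v
         \<longrightarrow> generic q (\<Lambda> - wt V v) \<longrightarrow> generic q (\<Lambda> - wt V v - wt W w)
         \<longrightarrow> J (w \<otimes> v) = fusion_vector q W V \<Lambda> w v))"

definition fusion_term :: "real \<Rightarrow> ('w::complex_vector) uq_ops \<Rightarrow> ('v::complex_vector) uq_ops
    \<Rightarrow> complex \<Rightarrow> 'w \<Rightarrow> 'v \<Rightarrow> nat \<Rightarrow> ('w, 'v) tensor"
  where "fusion_term q W V \<Lambda> w v l =
    (qpow q (- (of_nat l / 2) * (\<Lambda> + 1)) / qfact q l) *\<^sub>C
      ((opF W ^^ l) (fun_h W (\<lambda>z. qpow q (of_nat l * z / 4)) w)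
       \<otimes> (opE V ^^ l) (fun_h V (\<lambda>z. qpow q (of_nat l * z / 4) / qpoch q (- \<Lambda> + z) l) v))"

end

theory Submission
  imports Defs
begin

text \<open>An intertwining map out of a Verma module is determined by the image of the highest weight
  vector, which is a singular vector.  Writing a vector of \<open>M \<otimes> U\<close>, with \<open>M\<close> the Verma module of
  highest weight \<open>\<mu>\<close>, as \<open>\<Sum>k. f\<^sup>k x \<otimes> u\<^sub>k\<close>, singularity becomes the recursion
  \<open>[k + 1] [\<mu> - k] q\<^bsup>h/4\<^esup> u\<^sub>k\<^sub>+\<^sub>1 = - q\<^bsup>- (\<mu> - 2 k)/4\<^esup> e u\<^sub>k\<close>, solvable from any \<open>u\<^sub>0\<close> because
  \<open>\<mu>\<close> is generic; its solution is an explicit multiple of \<open>e\<^sup>k u\<^sub>0\<close>.  In the composition of two such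
  maps, the only summand of \<open>\<Delta>(f)\<^sup>k\<close> which does not raise the power of \<open>f\<close> in the Verma factor is
  \<open>(q\<^bsup>-h/4\<^esup> \<otimes> f)\<^sup>k\<close>, so that the leading vector is the sum of the
  multiples of \<open>f\<^sup>k w \<otimes> e\<^sup>k v\<close> in the formula.\<close>

section \<open>Linear maps\<close>

lemma clinear_iff:
  "clinear f \<longleftrightarrow> (\<forall>x y. f (x + y) = f x + f y) \<and> (\<forall>c x. f (c *\<^sub>C x) = c *\<^sub>C f x)"
  by (auto simp: Vector_Spaces.linear_iff intro: cvec.vector_space_axioms)

lemma clinearI:
  assumes "\<And>x y. f (x + y) = f x + f y" "\<And>c x. f (c *\<^sub>C x) = c *\<^sub>C f x"
  shows "clinear f"
  using assms by (simp add: clinear_iff)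

lemma clinear_add: "clinear f \<Longrightarrow> f (x + y) = f x + f y"
  and clinear_scale: "clinear f \<Longrightarrow> f (c *\<^sub>C x) = c *\<^sub>C f x"
  by (simp_all add: clinear_iff)

lemma clinear_0: "clinear f \<Longrightarrow> f 0 = 0"
  using clinear_scale[of f 0 0] by simp

lemma clinear_minus: "clinear f \<Longrightarrow> f (- x) = - f x"
  using clinear_scale[of f "-1" x] by simp

lemma clinear_diff: "clinear f \<Longrightarrow> f (x - y) = f x - f y"
  using clinear_add[of f x "- y"] clinear_minus[of f y] by simp

lemma clinear_sum: "clinear f \<Longrightarrow> f (\<Sum>i\<in>A. g i) = (\<Sum>i\<in>A. f (g i))"
  by (induction A rule: infinite_finite_induct) (simp_all add: clinear_0 clinear_add)

lemma clinear_id: "clinear (\<lambda>x. x)"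
  by (rule clinearI) simp_all

lemma clinear_id': "clinear id"
  by (rule clinearI) simp_all

lemma clinear_zero: "clinear (\<lambda>x. 0)"
  by (rule clinearI) simp_all

lemma clinear_compose: "clinear f \<Longrightarrow> clinear g \<Longrightarrow> clinear (\<lambda>x. f (g x))"
  by (simp add: clinear_iff)

lemma clinear_plus: "clinear f \<Longrightarrow> clinear g \<Longrightarrow> clinear (\<lambda>x. f x + g x)"
  by (simp add: clinear_iff cvec.scale_right_distrib algebra_simps)

lemma clinear_scaleC: "clinear f \<Longrightarrow> clinear (\<lambda>x. c *\<^sub>C f x)"
  by (simp add: clinear_iff cvec.scale_right_distrib cvec.scale_left_commute)

lemma clinear_funpow:
  fixes f :: "'a::complex_vector \<Rightarrow> 'a"
  shows "clinear f \<Longrightarrow> clinear (f ^^ n)"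
proof (induction n)
  case 0
  show ?case by (simp add: clinear_id)
next
  case (Suc n)
  from clinear_compose[OF Suc.prems Suc.IH[OF Suc.prems]] show ?case
    by (simp add: comp_def)
qed

lemma clinear_eq_on_span:
  assumes "clinear f" "clinear g" "x \<in> cvec.span B" "\<And>b. b \<in> B \<Longrightarrow> f b = g b"
  shows "f x = g x"
  using assms(3)
proof (induction rule: cvec.span_induct_alt)
  case base
  show ?case by (simp only: clinear_0[OF assms(1)] clinear_0[OF assms(2)])
next
  case (step c b y)
  then show ?case
    by (simp only: clinear_add[OF assms(1)] clinear_scale[OF assms(1)]
        clinear_add[OF assms(2)] clinear_scale[OF assms(2)] assms(4))
qed

lemma clinear_in_span:
  assumes "clinear f" "x \<in> cvec.span B" "\<And>b. b \<in> B \<Longrightarrow> f b \<in> cvec.span C"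
  shows "f x \<in> cvec.span C"
  using assms(2)
proof (induction rule: cvec.span_induct_alt)
  case base
  show ?case by (simp only: clinear_0[OF assms(1)] cvec.span_zero)
next
  case (step c b y)
  then show ?case
    by (simp only: clinear_add[OF assms(1)] clinear_scale[OF assms(1)] assms(3)
        cvec.span_add cvec.span_scale)
qed

global_interpretation cvec_pair:
  vector_space_pair "scaleC :: complex \<Rightarrow> 'a \<Rightarrow> 'a::complex_vector"
    "scaleC :: complex \<Rightarrow> 'b \<Rightarrow> 'b::complex_vector"
  by unfold_locales

lemma exists_functional:
  fixes x :: "'a::complex_vector"
  assumes "x \<noteq> 0"
  shows "\<exists>\<phi> :: 'a \<Rightarrow> complex. clinear \<phi> \<and> \<phi> x = 1"
proof -
  have "cvec.independent {x}"
    using assms by (simp add: cvec.dependent_single)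
  from cvec_pair.linear_independent_extend[OF this, of "\<lambda>_. 1::complex"]
  show ?thesis by auto
qed

subsection \<open>Linear extension from a basis\<close>

definition free_ext :: "('i \<Rightarrow> 'v::complex_vector) \<Rightarrow> ('i \<Rightarrow>\<^sub>0 complex) \<Rightarrow> 'v"
  where "free_ext g p = (\<Sum>k\<in>Poly_Mapping.keys p. Poly_Mapping.lookup p k *\<^sub>C g k)"

lemma free_ext_superset:
  assumes "finite A" "Poly_Mapping.keys p \<subseteq> A"
  shows "free_ext g p = (\<Sum>k\<in>A. Poly_Mapping.lookup p k *\<^sub>C g k)"
  unfolding free_ext_def using assms
  by (intro sum.mono_neutral_left) (auto simp: in_keys_iff)

lemma clinear_free_ext: "clinear (free_ext g)"
proof (rule clinearI)
  show "free_ext g (p + r) = free_ext g p + free_ext g r" for p r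
    unfolding free_ext_def
    by (rule setsum_keys_plus_distrib) (simp_all add: cvec.scale_left_distrib)
  show "free_ext g (c *\<^sub>C p) = c *\<^sub>C free_ext g p" for c p
  proof -
    have "Poly_Mapping.keys (c *\<^sub>C p) \<subseteq> Poly_Mapping.keys p"
      by (auto simp: in_keys_iff lookup_scaleC)
    then show ?thesis
      by (subst (1 2) free_ext_superset[where A = "Poly_Mapping.keys p"])
        (simp_all add: cvec.scale_sum_right lookup_scaleC scaleC_complex_def)
  qed
qed

lemma free_ext_single: "free_ext g (Poly_Mapping.single k c) = c *\<^sub>C g k"
  by (simp add: free_ext_def)

lemma free_ext_single_id: "free_ext (\<lambda>k. Poly_Mapping.single k 1) p = p"
proof (rule poly_mapping_eqI)
  fix j
  have "Poly_Mapping.lookup (free_ext (\<lambda>k. Poly_Mapping.single k 1) p) j =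
        (\<Sum>k\<in>Poly_Mapping.keys p. if k = j then Poly_Mapping.lookup p k else 0)"
    unfolding free_ext_def lookup_sum
    by (rule sum.cong) (simp_all add: lookup_scaleC lookup_single when_def scaleC_complex_def)
  also have "\<dots> = Poly_Mapping.lookup p j"
    by (simp add: sum.delta in_keys_iff)
  finally show "Poly_Mapping.lookup (free_ext (\<lambda>k. Poly_Mapping.single k 1) p) j
      = Poly_Mapping.lookup p j" .
qed

lemma clinear_free_ext_eq:
  fixes f :: "('i \<Rightarrow>\<^sub>0 complex) \<Rightarrow> 'v::complex_vector"
  assumes "clinear f"
  shows "f p = free_ext (\<lambda>k. f (Poly_Mapping.single k 1)) p"
proof -
  have "f p = f (free_ext (\<lambda>k. Poly_Mapping.single k 1) p)"
    by (simp only: free_ext_single_id)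
  also have "\<dots> = free_ext (\<lambda>k. f (Poly_Mapping.single k 1)) p"
    by (simp only: free_ext_def clinear_sum[OF assms] clinear_scale[OF assms])
  finally show ?thesis .
qed

lemma clinear_free_eqI:
  fixes f g :: "('i \<Rightarrow>\<^sub>0 complex) \<Rightarrow> 'v::complex_vector"
  assumes "clinear f" "clinear g"
    and "\<And>k. f (Poly_Mapping.single k 1) = g (Poly_Mapping.single k 1)"
  shows "f = g"
proof
  fix p
  have "f p = free_ext (\<lambda>k. f (Poly_Mapping.single k 1)) p"
    by (rule clinear_free_ext_eq[OF assms(1)])
  also have "\<dots> = g p"
    by (simp only: assms(3) clinear_free_ext_eq[OF assms(2), symmetric])
  finally show "f p = g p" .
qed

section \<open>Tensor products\<close>

lemma tens_add_left: "(a + a') \<otimes> b = a \<otimes> b + a' \<otimes> b"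
proof (transfer, unfold tensor_eq_def)
  fix a a' :: 'a and b :: 'b
  have "Poly_Mapping.single (a + a', b) 1 - Poly_Mapping.single (a, b) 1
        - Poly_Mapping.single (a', b) 1 \<in> (tensor_relations :: ('a \<times> 'b \<Rightarrow>\<^sub>0 complex) set)"
    unfolding tensor_relations_def
    by (rule UnI1, rule UnI1, rule UnI1, rule CollectI, (rule exI)+, rule conjI[OF refl TrueI])
  from cvec.span_base[OF this]
  show "Poly_Mapping.single (a + a', b) 1 - (Poly_Mapping.single (a, b) 1
        + Poly_Mapping.single (a', b) 1) \<in> cvec.span tensor_relations"
    by (simp add: diff_diff_eq)
qed

lemma tens_add_right: "a \<otimes> (b + b') = a \<otimes> b + a \<otimes> b'"
proof (transfer, unfold tensor_eq_def)
  fix a :: 'a and b b' :: 'b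
  have "Poly_Mapping.single (a, b + b') 1 - Poly_Mapping.single (a, b) 1
        - Poly_Mapping.single (a, b') 1 \<in> (tensor_relations :: ('a \<times> 'b \<Rightarrow>\<^sub>0 complex) set)"
    unfolding tensor_relations_def
    by (rule UnI1, rule UnI1, rule UnI2, rule CollectI, (rule exI)+, rule conjI[OF refl TrueI])
  from cvec.span_base[OF this]
  show "Poly_Mapping.single (a, b + b') 1 - (Poly_Mapping.single (a, b) 1
        + Poly_Mapping.single (a, b') 1) \<in> cvec.span tensor_relations"
    by (simp add: diff_diff_eq)
qed

lemma tens_scale_left: "(c *\<^sub>C a) \<otimes> b = c *\<^sub>C (a \<otimes> b)"
proof (transfer, unfold tensor_eq_def)
  fix a :: 'a and b :: 'b and c
  show "Poly_Mapping.single (c *\<^sub>C a, b) 1 - c *\<^sub>C Poly_Mapping.single (a, b) 1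
      \<in> cvec.span tensor_relations"
    unfolding tensor_relations_def
    by (rule cvec.span_base, rule UnI1, rule UnI2, rule CollectI, (rule exI)+, rule conjI[OF refl TrueI])
qed

lemma tens_scale_right: "a \<otimes> (c *\<^sub>C b) = c *\<^sub>C (a \<otimes> b)"
proof (transfer, unfold tensor_eq_def)
  fix a :: 'a and b :: 'b and c
  show "Poly_Mapping.single (a, c *\<^sub>C b) 1 - c *\<^sub>C Poly_Mapping.single (a, b) 1
      \<in> cvec.span tensor_relations"
    unfolding tensor_relations_def
    by (rule cvec.span_base, rule UnI2, rule CollectI, (rule exI)+, rule conjI[OF refl TrueI])
qed

lemma clinear_tens_left: "clinear (\<lambda>a. a \<otimes> b)"
  and clinear_tens_right: "clinear (\<lambda>b. a \<otimes> b)"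
  by (simp_all add: clinear_iff tens_add_left tens_add_right tens_scale_left tens_scale_right)

lemmas tens_zero_left [simp] = clinear_0[OF clinear_tens_left]
lemmas tens_zero_right [simp] = clinear_0[OF clinear_tens_right]

lemma tensor_induct [case_names tens add]:
  assumes tens: "\<And>a b. P (a \<otimes> b)" and add: "\<And>s t. P s \<Longrightarrow> P t \<Longrightarrow> P (s + t)"
  shows "P t"
proof -
  let ?S = "{a \<otimes> b | a b. True}"
  have lin: "clinear abs_tensor"
    by (rule clinearI) (simp_all add: plus_tensor.abs_eq scaleC_tensor.abs_eq)
  have "abs_tensor p \<in> cvec.span ?S" for p
  proof -
    have "abs_tensor p = free_ext (\<lambda>k. abs_tensor (Poly_Mapping.single k 1)) p"
      by (rule clinear_free_ext_eq[OF lin])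
    also have "\<dots> \<in> cvec.span ?S"
      unfolding free_ext_def
    proof (rule cvec.span_sum, rule cvec.span_scale, rule cvec.span_base)
      fix k
      show "abs_tensor (Poly_Mapping.single k 1) \<in> ?S"
        by (cases k) (auto simp: tens.abs_eq intro!: exI)
    qed
    finally show ?thesis .
  qed
  then have "abs_tensor (rep_tensor t) \<in> cvec.span ?S" .
  then have "t \<in> cvec.span ?S"
    by (simp only: Quotient_abs_rep[OF Quotient_tensor])
  then show ?thesis
  proof (induction rule: cvec.span_induct_alt)
    case base
    show ?case using tens[of 0 0] by simp
  next
    case (step c x y)
    then obtain a b where "x = a \<otimes> b" by auto
    then have "c *\<^sub>C x = (c *\<^sub>C a) \<otimes> b" by (simp add: tens_scale_left)
    then have "P (c *\<^sub>C x)" by (simp only: tens)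
    then show ?case using step.IH by (rule add)
  qed
qed

lemma clinear_tensor_eqI:
  assumes "clinear f" "clinear g" "\<And>a b. f (a \<otimes> b) = g (a \<otimes> b)"
  shows "f = g"
proof
  show "f t = g t" for t
    by (induction t rule: tensor_induct)
      (simp_all only: assms(3) clinear_add[OF assms(1)] clinear_add[OF assms(2)])
qed

definition cbilinear :: "('a::complex_vector \<Rightarrow> 'b::complex_vector \<Rightarrow> 'c::complex_vector) \<Rightarrow> bool"
  where "cbilinear B \<longleftrightarrow> (\<forall>y. clinear (\<lambda>x. B x y)) \<and> (\<forall>x. clinear (B x))"

lemma cbilinearI:
  assumes "\<And>y. clinear (\<lambda>x. B x y)" "\<And>x. clinear (B x)"
  shows "cbilinear B"
  using assms by (simp add: cbilinear_def)

lemma cbilinearD: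
  assumes "cbilinear B"
  shows "B (x + x') y = B x y + B x' y" "B x (y + y') = B x y + B x y'"
    "B (c *\<^sub>C x) y = c *\<^sub>C B x y" "B x (c *\<^sub>C y) = c *\<^sub>C B x y"
  using assms by (simp_all add: cbilinear_def clinear_iff)

lift_definition tensor_lift ::
  "('a::complex_vector \<Rightarrow> 'b::complex_vector \<Rightarrow> 'c::complex_vector) \<Rightarrow> ('a, 'b) tensor \<Rightarrow> 'c"
  is "\<lambda>B p. if cbilinear B then free_ext (\<lambda>(a, b). B a b) p else 0"
proof -
  fix B :: "'a \<Rightarrow> 'b \<Rightarrow> 'c" and p r :: "'a \<times> 'b \<Rightarrow>\<^sub>0 complex"
  let ?F = "free_ext (\<lambda>(a, b). B a b)"
  assume eq: "tensor_eq p r"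
  show "(if cbilinear B then ?F p else 0) = (if cbilinear B then ?F r else 0)"
  proof (cases "cbilinear B")
    case True
    have 0: "?F s = 0" if "s \<in> tensor_relations" for s
      using that unfolding tensor_relations_def
      by (elim UnE CollectE exE conjE; hypsubst;
          simp add: clinear_diff[OF clinear_free_ext] clinear_scale[OF clinear_free_ext]
          free_ext_single cbilinearD[OF True])
    have "p - r \<in> cvec.span tensor_relations"
      using eq by (simp only: tensor_eq_def)
    then have "?F (p - r) = 0"
      by (rule clinear_eq_on_span[OF clinear_free_ext clinear_zero _ 0])
    then show ?thesis
      by (simp add: clinear_diff[OF clinear_free_ext])
  qed simp
qed

lemma tensor_lift_tens: "cbilinear B \<Longrightarrow> tensor_lift B (a \<otimes> b) = B a b"
  by transfer (simp add: free_ext_single)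

lemma clinear_tensor_lift: "clinear (tensor_lift B)"
proof (rule clinearI)
  show "tensor_lift B (s + t) = tensor_lift B s + tensor_lift B t" for s t
    by transfer (simp add: clinear_add[OF clinear_free_ext])
  show "tensor_lift B (c *\<^sub>C t) = c *\<^sub>C tensor_lift B t" for c t
    by transfer (simp add: clinear_scale[OF clinear_free_ext])
qed

lemma tensor_map_unique:
  assumes "clinear S" "clinear T"
  shows "\<exists>!F. clinear F \<and> (\<forall>a b. F (a \<otimes> b) = S a \<otimes> T b)"
proof -
  have "cbilinear (\<lambda>a b. S a \<otimes> T b)"
    using assms
    by (intro cbilinearI clinear_compose[OF clinear_tens_left] clinear_compose[OF clinear_tens_right])
  then show ?thesis
    by (intro ex1I[of _ "tensor_lift (\<lambda>a b. S a \<otimes> T b)"])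
      (simp_all add: clinear_tensor_lift tensor_lift_tens clinear_tensor_eqI)
qed

lemma
  assumes "clinear S" "clinear T"
  shows clinear_tensor_map: "clinear (tensor_map S T)"
    and tensor_map_tens: "tensor_map S T (a \<otimes> b) = S a \<otimes> T b"
proof -
  have "clinear (tensor_map S T) \<and> (\<forall>a b. tensor_map S T (a \<otimes> b) = S a \<otimes> T b)"
    unfolding tensor_map_def by (rule theI'[OF tensor_map_unique[OF assms]])
  then show "clinear (tensor_map S T)" "tensor_map S T (a \<otimes> b) = S a \<otimes> T b"
    by simp_all
qed

lemma tensor_assoc_unique:
  "\<exists>!F. clinear F \<and> (\<forall>(a::'a::complex_vector) (b::'b::complex_vector) (c::'c::complex_vector).
     F ((a \<otimes> b) \<otimes> c) = a \<otimes> (b \<otimes> c))"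
proof -
  let ?R = "\<lambda>c (b::'b). b \<otimes> (c::'c)"
  let ?B = "\<lambda>(t :: ('a, 'b) tensor) (c::'c). tensor_map (\<lambda>a. a) (?R c) t"
  have R: "clinear (?R c)" for c by (rule clinear_tens_left)
  note tm = clinear_tensor_map[OF clinear_id R] tensor_map_tens[OF clinear_id R]
  have "clinear (?B t)" for t
  proof (induction t rule: tensor_induct)
    case (tens a b)
    have "(\<lambda>c. ?B (a \<otimes> b) c) = (\<lambda>c. a \<otimes> (b \<otimes> c))"
      by (rule ext) (simp only: tm)
    then show ?case
      by (simp only: clinear_compose[OF clinear_tens_right clinear_tens_right])
  next
    case (add s t)
    have "(\<lambda>c. ?B (s + t) c) = (\<lambda>c. ?B s c + ?B t c)"
      by (rule ext) (rule clinear_add[OF tm(1)])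
    then show ?case
      using clinear_plus[OF add] by (simp only:)
  qed
  then have "cbilinear ?B"
    by (intro cbilinearI tm(1))
  note lift = tensor_lift_tens[OF this]
  show ?thesis
  proof (rule ex1I[of _ "tensor_lift ?B"], intro conjI allI)
    show "clinear (tensor_lift ?B)" by (rule clinear_tensor_lift)
    show "tensor_lift ?B ((a \<otimes> b) \<otimes> c) = a \<otimes> (b \<otimes> c)" for a b c
      by (simp add: lift tm)
    fix F :: "(('a, 'b) tensor, 'c) tensor \<Rightarrow> ('a, ('b, 'c) tensor) tensor"
    assume F: "clinear F \<and> (\<forall>a b c. F ((a \<otimes> b) \<otimes> c) = a \<otimes> (b \<otimes> c))"
    show "F = tensor_lift ?B"
    proof (rule clinear_tensor_eqI)
      show "clinear F" "clinear (tensor_lift ?B)"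
        using F clinear_tensor_lift by auto
      show "F (t \<otimes> c) = tensor_lift ?B (t \<otimes> c)" for t c
      proof (induction t rule: tensor_induct)
        case (tens a b)
        then show ?case using F by (simp add: lift tm)
      next
        case (add s t)
        then show ?case
          by (simp only: tens_add_left clinear_add[OF F[THEN conjunct1]]
              clinear_add[OF clinear_tensor_lift])
      qed
    qed
  qed
qed

lemma tensor_assoc_aux:
  "clinear (tensor_assoc ::
     (('a::complex_vector, 'b::complex_vector) tensor, 'c::complex_vector) tensor \<Rightarrow> _)
   \<and> (\<forall>(a::'a) (b::'b) (c::'c). tensor_assoc ((a \<otimes> b) \<otimes> c) = a \<otimes> (b \<otimes> c))"
  unfolding tensor_assoc_def by (rule theI'[OF tensor_assoc_unique])

lemmas clinear_tensor_assoc = tensor_assoc_aux[THEN conjunct1]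

lemma tensor_assoc_tens: "tensor_assoc ((a \<otimes> b) \<otimes> c) = a \<otimes> (b \<otimes> c)"
  by (rule tensor_assoc_aux[THEN conjunct2, rule_format])

lemma tens_nonzero:
  assumes "a \<noteq> 0" "b \<noteq> 0"
  shows "a \<otimes> b \<noteq> 0"
proof -
  from exists_functional[OF assms(1)] obtain \<phi> where "clinear \<phi> \<and> \<phi> a = (1::complex)" ..
  then have \<phi>: "clinear \<phi>" "\<phi> a = (1::complex)" by simp_all
  from exists_functional[OF assms(2)] obtain \<psi> where "clinear \<psi> \<and> \<psi> b = (1::complex)" ..
  then have \<psi>: "clinear \<psi>" "\<psi> b = (1::complex)" by simp_all
  have "cbilinear (\<lambda>a b. \<phi> a * \<psi> b)"
    by (intro cbilinearI clinearI)
      (simp_all add: clinear_add[OF \<phi>(1)] clinear_add[OF \<psi>(1)] clinear_scale[OF \<phi>(1)]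
        clinear_scale[OF \<psi>(1)] scaleC_complex_def algebra_simps)
  from tensor_lift_tens[OF this, of a b] have "tensor_lift (\<lambda>a b. \<phi> a * \<psi> b) (a \<otimes> b) = 1"
    using \<phi> \<psi> by simp
  then show ?thesis
    using clinear_0[OF clinear_tensor_lift, of "\<lambda>a b. \<phi> a * \<psi> b"] by auto
qed

section \<open>Weight decompositions\<close>

lemma weight_space_iff: "v \<in> weight_space V \<nu> \<longleftrightarrow> opH V v = \<nu> *\<^sub>C v"
  by (simp add: weight_space_def)

lemma subspace_weight_space:
  assumes "clinear (opH V)"
  shows "cvec.subspace (weight_space V \<nu>)"
  by (rule cvec.subspaceI)
    (simp_all add: weight_space_iff clinear_0[OF assms] clinear_add[OF assms]
      clinear_scale[OF assms] cvec.scale_right_distrib cvec.scale_left_commute)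

lemma weight_sum_zero:
  assumes H: "clinear (opH V)" and "finite A"
    and "\<And>\<nu>. \<nu> \<in> A \<Longrightarrow> x \<nu> \<in> weight_space V \<nu>" and "(\<Sum>\<nu>\<in>A. x \<nu>) = 0"
  shows "\<forall>\<nu>\<in>A. x \<nu> = 0"
  using assms(2-4)
proof (induction A arbitrary: x rule: finite_induct)
  case (insert a A)
  let ?S = "\<Sum>\<nu>\<in>A. x \<nu>"
  have xa: "x a = - ?S"
    using insert by (simp add: eq_neg_iff_add_eq_0)
  have "opH V ?S = (\<Sum>\<nu>\<in>A. \<nu> *\<^sub>C x \<nu>)"
    unfolding clinear_sum[OF H]
    by (rule sum.cong) (use insert.prems(1) in \<open>auto simp: weight_space_iff\<close>)
  moreover have "opH V (- ?S) = a *\<^sub>C (- ?S)"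
    using insert.prems(1)[of a] by (simp add: weight_space_iff xa)
  ultimately have "(\<Sum>\<nu>\<in>A. \<nu> *\<^sub>C x \<nu>) = (\<Sum>\<nu>\<in>A. a *\<^sub>C x \<nu>)"
    by (simp add: clinear_minus[OF H] cvec.scale_sum_right)
  then have "(\<Sum>\<nu>\<in>A. (\<nu> - a) *\<^sub>C x \<nu>) = 0"
    by (simp add: cvec.scale_left_diff_distrib sum_subtractf)
  moreover have "(\<nu> - a) *\<^sub>C x \<nu> \<in> weight_space V \<nu>" if "\<nu> \<in> A" for \<nu>
    using insert.prems(1)[of \<nu>] that by (simp add: cvec.subspace_scale[OF subspace_weight_space[OF H]])
  ultimately have "\<forall>\<nu>\<in>A. (\<nu> - a) *\<^sub>C x \<nu> = 0"
    by (intro insert.IH)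
  with insert.hyps have "\<forall>\<nu>\<in>A. x \<nu> = 0"
    by auto
  with xa show ?case by simp
qed simp

definition weight_spanned :: "('v::complex_vector) uq_ops \<Rightarrow> bool"
  where "weight_spanned V \<longleftrightarrow> clinear (opH V) \<and> cvec.span (\<Union>\<nu>. weight_space V \<nu>) = UNIV"

definition weight_decomp :: "('v::complex_vector) uq_ops \<Rightarrow> 'v \<Rightarrow> (complex \<Rightarrow>\<^sub>0 'v) \<Rightarrow> bool"
  where "weight_decomp V v d \<longleftrightarrow> (\<forall>\<nu>. Poly_Mapping.lookup d \<nu> \<in> weight_space V \<nu>)
    \<and> v = (\<Sum>\<nu>\<in>Poly_Mapping.keys d. Poly_Mapping.lookup d \<nu>)"

definition weighted_sum :: "(complex \<Rightarrow> complex) \<Rightarrow> (complex \<Rightarrow>\<^sub>0 'v::complex_vector) \<Rightarrow> 'v"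
  where "weighted_sum g d = (\<Sum>\<nu>\<in>Poly_Mapping.keys d. g \<nu> *\<^sub>C Poly_Mapping.lookup d \<nu>)"

lemma weighted_sum_superset:
  assumes "finite A" "Poly_Mapping.keys d \<subseteq> A"
  shows "weighted_sum g d = (\<Sum>\<nu>\<in>A. g \<nu> *\<^sub>C Poly_Mapping.lookup d \<nu>)"
  unfolding weighted_sum_def using assms
  by (intro sum.mono_neutral_left) (auto simp: in_keys_iff)

lemma clinear_weighted_sum: "clinear (weighted_sum g)"
proof (rule clinearI)
  show "weighted_sum g (p + r) = weighted_sum g p + weighted_sum g r" for p r :: "complex \<Rightarrow>\<^sub>0 'a"
    unfolding weighted_sum_def
    by (rule setsum_keys_plus_distrib) (simp_all add: cvec.scale_right_distrib)
  show "weighted_sum g (c *\<^sub>C p) = c *\<^sub>C weighted_sum g p" for c and p :: "complex \<Rightarrow>\<^sub>0 'a"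
  proof -
    have "Poly_Mapping.keys (c *\<^sub>C p) \<subseteq> Poly_Mapping.keys p"
      by (auto simp: in_keys_iff lookup_scaleC)
    then show ?thesis
      by (subst (1 2) weighted_sum_superset[where A = "Poly_Mapping.keys p"])
        (simp_all add: cvec.scale_sum_right lookup_scaleC mult.commute)
  qed
qed

lemma weighted_sum_single: "weighted_sum g (Poly_Mapping.single \<nu> v) = g \<nu> *\<^sub>C v"
  by (simp add: weighted_sum_def)

lemma weight_decomp_iff:
  "weight_decomp V v d \<longleftrightarrow>
    (\<forall>\<nu>. Poly_Mapping.lookup d \<nu> \<in> weight_space V \<nu>) \<and> v = weighted_sum (\<lambda>_. 1) d"
  by (simp add: weight_decomp_def weighted_sum_def)

lemma weight_decomp_add:
  assumes "clinear (opH V)" "weight_decomp V v d" "weight_decomp V w e"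
  shows "weight_decomp V (v + w) (d + e)"
  using assms
  by (simp add: weight_decomp_iff lookup_add clinear_add[OF clinear_weighted_sum]
      cvec.subspace_add[OF subspace_weight_space])

lemma weight_decomp_scale:
  assumes "clinear (opH V)" "weight_decomp V v d"
  shows "weight_decomp V (c *\<^sub>C v) (c *\<^sub>C d)"
  using assms
  by (simp add: weight_decomp_iff lookup_scaleC clinear_scale[OF clinear_weighted_sum]
      cvec.subspace_scale[OF subspace_weight_space])

lemma weight_decomp_single:
  assumes "clinear (opH V)" "v \<in> weight_space V \<nu>"
  shows "weight_decomp V v (Poly_Mapping.single \<nu> v)"
  using assms
  by (simp add: weight_decomp_iff lookup_single when_def weighted_sum_single
      cvec.subspace_0[OF subspace_weight_space])

lemma weight_decomp_unique:
  assumes H: "clinear (opH V)" and "weight_decomp V v d" "weight_decomp V v e"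
  shows "d = e"
proof -
  let ?K = "Poly_Mapping.keys d \<union> Poly_Mapping.keys e"
  have "weight_decomp V (v + (-1) *\<^sub>C v) (d + (-1) *\<^sub>C e)"
    using assms by (intro weight_decomp_add weight_decomp_scale)
  then have de: "weight_decomp V 0 (d - e)"
    by simp
  have K: "Poly_Mapping.keys (d - e) \<subseteq> ?K"
    by (auto simp: in_keys_iff lookup_minus)
  have "\<forall>\<nu>\<in>?K. Poly_Mapping.lookup (d - e) \<nu> = 0"
  proof (rule weight_sum_zero[OF H])
    show "(\<Sum>\<nu>\<in>?K. Poly_Mapping.lookup (d - e) \<nu>) = 0"
      using de weighted_sum_superset[OF _ K, of "\<lambda>_. 1"] by (simp add: weight_decomp_iff)
  qed (use de in \<open>auto simp: weight_decomp_iff\<close>)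
  then have 0: "Poly_Mapping.lookup d \<nu> = Poly_Mapping.lookup e \<nu>" if "\<nu> \<in> ?K" for \<nu>
    using that by (simp add: lookup_minus)
  show ?thesis
  proof (rule poly_mapping_eqI)
    fix \<nu>
    show "Poly_Mapping.lookup d \<nu> = Poly_Mapping.lookup e \<nu>"
      by (cases "\<nu> \<in> ?K") (simp add: 0, simp add: in_keys_iff)
  qed
qed

lemma weight_decomp_exists:
  assumes "weight_spanned V"
  shows "\<exists>d. weight_decomp V v d"
proof -
  have H: "clinear (opH V)" and "v \<in> cvec.span (\<Union>\<nu>. weight_space V \<nu>)"
    using assms by (simp_all add: weight_spanned_def)
  from this(2) show ?thesis
  proof (induction rule: cvec.span_induct_alt)
    case base
    show ?case
      by (rule exI[of _ 0])
        (simp add: weight_decomp_def cvec.subspace_0[OF subspace_weight_space[OF H]])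
  next
    case (step c x y)
    then obtain \<nu> d where "x \<in> weight_space V \<nu>" "weight_decomp V y d" by auto
    then show ?case
      using weight_decomp_add[OF H weight_decomp_scale[OF H weight_decomp_single[OF H]]] by blast
  qed
qed

lemma weight_spanned_eqI:
  assumes "weight_spanned V" "clinear f" "clinear g"
    and "\<And>\<nu> x. x \<in> weight_space V \<nu> \<Longrightarrow> f x = g x"
  shows "f = g"
proof
  fix x
  show "f x = g x"
    by (rule clinear_eq_on_span[OF assms(2,3), of _ "\<Union>\<nu>. weight_space V \<nu>"])
      (use assms(1,4) in \<open>auto simp: weight_spanned_def\<close>)
qed

lemma fun_h_unique:
  assumes V: "weight_spanned V"
  shows "\<exists>!T. clinear T \<and> (\<forall>\<nu>. \<forall>v\<in>weight_space V \<nu>. T v = g \<nu> *\<^sub>C v)"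
proof -
  have H: "clinear (opH V)" using V by (simp add: weight_spanned_def)
  define D where "D v = (SOME d. weight_decomp V v d)" for v
  have D: "weight_decomp V v (D v)" for v
    unfolding D_def by (rule someI_ex[OF weight_decomp_exists[OF V]])
  have DI: "D v = d" if "weight_decomp V v d" for v d
    by (rule weight_decomp_unique[OF H D that])
  have D_add: "D (x + y) = D x + D y" for x y
    by (intro DI weight_decomp_add H D)
  have D_scale: "D (c *\<^sub>C x) = c *\<^sub>C D x" for c x
    by (intro DI weight_decomp_scale H D)
  show ?thesis
  proof (rule ex1I[of _ "\<lambda>v. weighted_sum g (D v)"], intro conjI allI ballI)
    show "clinear (\<lambda>v. weighted_sum g (D v))"
      by (rule clinearI) (simp_all only: D_add D_scale clinear_add[OF clinear_weighted_sum]
          clinear_scale[OF clinear_weighted_sum])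
    show "weighted_sum g (D v) = g \<nu> *\<^sub>C v" if "v \<in> weight_space V \<nu>" for \<nu> v
      by (simp only: DI[OF weight_decomp_single[OF H that]] weighted_sum_single)
    fix T assume T: "clinear T \<and> (\<forall>\<nu>. \<forall>v\<in>weight_space V \<nu>. T v = g \<nu> *\<^sub>C v)"
    show "T = (\<lambda>v. weighted_sum g (D v))"
    proof (rule weight_spanned_eqI[OF V])
      show "T x = weighted_sum g (D x)" if "x \<in> weight_space V \<nu>" for \<nu> x
        using T that by (simp only: DI[OF weight_decomp_single[OF H that]] weighted_sum_single)
    qed (use T \<open>clinear (\<lambda>v. weighted_sum g (D v))\<close> in auto)
  qed
qed

lemma fun_h_aux:
  assumes "weight_spanned V"
  shows "clinear (fun_h V g) \<and> (\<forall>\<nu>. \<forall>v\<in>weight_space V \<nu>. fun_h V g v = g \<nu> *\<^sub>C v)"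
  unfolding fun_h_def by (rule theI'[OF fun_h_unique[OF assms]])

lemmas clinear_fun_h = fun_h_aux[THEN conjunct1]

lemma fun_h_weight: "weight_spanned V \<Longrightarrow> v \<in> weight_space V \<nu> \<Longrightarrow> fun_h V g v = g \<nu> *\<^sub>C v"
  by (rule fun_h_aux[THEN conjunct2, rule_format])

lemma weight_spannedI:
  assumes "clinear (opH V)" and G: "\<And>x \<nu>. (x, \<nu>) \<in> G \<Longrightarrow> x \<in> weight_space V \<nu>"
    and span: "cvec.span (fst ` G) = UNIV"
  shows "weight_spanned V"
proof -
  have "fst ` G \<subseteq> (\<Union>\<nu>. weight_space V \<nu>)" using G by force
  then have "UNIV \<subseteq> cvec.span (\<Union>\<nu>. weight_space V \<nu>)"
    using cvec.span_mono span by blast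
  then show ?thesis
    using assms(1) by (simp add: weight_spanned_def top.extremum_unique)
qed

lemma weight_space_span:
  assumes H: "clinear (opH V)" and G: "\<And>x \<nu>. (x, \<nu>) \<in> G \<Longrightarrow> x \<in> weight_space V \<nu>"
    and span: "cvec.span (fst ` G) = UNIV" and v: "v \<in> weight_space V \<nu>"
  shows "v \<in> cvec.span {x. (x, \<nu>) \<in> G}"
proof -
  have V: "weight_spanned V"
    by (rule weight_spannedI[OF H G span])
  let ?\<pi> = "fun_h V (\<lambda>z. if z = \<nu> then 1 else 0)"
  have "?\<pi> v \<in> cvec.span {x. (x, \<nu>) \<in> G}"
  proof (rule clinear_in_span[OF clinear_fun_h[OF V], of _ "fst ` G"])
    show "v \<in> cvec.span (fst ` G)" by (simp add: span)
    fix b assume "b \<in> fst ` G"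
    then obtain \<mu> where b: "(b, \<mu>) \<in> G" by auto
    then show "?\<pi> b \<in> cvec.span {x. (x, \<nu>) \<in> G}"
      using b by (auto simp: fun_h_weight[OF V G[OF b]] intro: cvec.span_base cvec.span_zero)
  qed
  then show ?thesis
    by (simp add: fun_h_weight[OF V v])
qed

section \<open>Modules\<close>

lemma uq_moduleD:
  assumes "uq_module q V"
  shows clinear_opE: "clinear (opE V)" and clinear_opF: "clinear (opF V)"
    and clinear_opH: "clinear (opH V)"
    and opE_weight: "v \<in> weight_space V \<nu> \<Longrightarrow> opE V v \<in> weight_space V (\<nu> + 2)"
    and opF_weight: "v \<in> weight_space V \<nu> \<Longrightarrow> opF V v \<in> weight_space V (\<nu> - 2)"
    and opE_opF: "v \<in> weight_space V \<nu> \<Longrightarrow> opE V (opF V v) - opF V (opE V v) = qnum q \<nu> *\<^sub>C v"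
    and weights_bounded: "\<exists>B. \<forall>\<nu>. weight_space V \<nu> \<noteq> {0} \<longrightarrow> Re \<nu> \<le> B"
proof -
  note A = assms[unfolded uq_module_def]
  show "clinear (opE V)" by (rule A[THEN conjunct1])
  show "clinear (opF V)" by (rule A[THEN conjunct2, THEN conjunct1])
  show "clinear (opH V)" by (rule A[THEN conjunct2, THEN conjunct2, THEN conjunct1])
  show "\<exists>B. \<forall>\<nu>. weight_space V \<nu> \<noteq> {0} \<longrightarrow> Re \<nu> \<le> B"
    using A by (elim conjE)
  assume v: "v \<in> weight_space V \<nu>"
  have "\<forall>\<nu>. opE V ` weight_space V \<nu> \<subseteq> weight_space V (\<nu> + 2)"
    using A by (elim conjE)
  with v show "opE V v \<in> weight_space V (\<nu> + 2)" by blast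
  have "\<forall>\<nu>. opF V ` weight_space V \<nu> \<subseteq> weight_space V (\<nu> - 2)"
    using A by (elim conjE)
  with v show "opF V v \<in> weight_space V (\<nu> - 2)" by blast
  have "\<forall>\<nu>. \<forall>v\<in>weight_space V \<nu>. opE V (opF V v) - opF V (opE V v) = qnum q \<nu> *\<^sub>C v"
    using A by (elim conjE)
  with v show "opE V (opF V v) - opF V (opE V v) = qnum q \<nu> *\<^sub>C v" by simp
qed

lemma uq_module_weight_spanned:
  assumes "uq_module q V"
  shows "weight_spanned V"
proof -
  have "v \<in> cvec.span (\<Union>\<nu>. weight_space V \<nu>)" for v
  proof -
    have "\<exists>d :: complex \<Rightarrow>\<^sub>0 'a. (\<forall>\<nu>. Poly_Mapping.lookup d \<nu> \<in> weight_space V \<nu>)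
        \<and> v = (\<Sum>\<nu>\<in>Poly_Mapping.keys d. Poly_Mapping.lookup d \<nu>)"
      using assms[unfolded uq_module_def, THEN conjunct2, THEN conjunct2, THEN conjunct2,
          THEN conjunct1, rule_format, of v] by (rule ex1_implies_ex)
    then obtain d :: "complex \<Rightarrow>\<^sub>0 'a" where "\<And>\<nu>. Poly_Mapping.lookup d \<nu> \<in> weight_space V \<nu>"
      and v: "v = (\<Sum>\<nu>\<in>Poly_Mapping.keys d. Poly_Mapping.lookup d \<nu>)" by blast
    then have "Poly_Mapping.lookup d \<nu> \<in> cvec.span (\<Union>\<nu>. weight_space V \<nu>)" for \<nu>
      by (intro cvec.span_base) blast
    then show ?thesis
      unfolding v by (rule cvec.span_sum)
  qed
  then show ?thesis
    using clinear_opH[OF assms] by (auto simp: weight_spanned_def)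
qed

lemma uq_moduleI:
  assumes lin: "clinear (opE V)" "clinear (opF V)" "clinear (opH V)"
    and span: "cvec.span (fst ` G) = UNIV"
    and H: "\<And>x \<nu>. (x, \<nu>) \<in> G \<Longrightarrow> x \<in> weight_space V \<nu>"
    and E: "\<And>x \<nu>. (x, \<nu>) \<in> G \<Longrightarrow> opE V x \<in> weight_space V (\<nu> + 2)"
    and F: "\<And>x \<nu>. (x, \<nu>) \<in> G \<Longrightarrow> opF V x \<in> weight_space V (\<nu> - 2)"
    and EF: "\<And>x \<nu>. (x, \<nu>) \<in> G \<Longrightarrow> opE V (opF V x) - opF V (opE V x) = qnum q \<nu> *\<^sub>C x"
    and bd: "\<And>x \<nu>. (x, \<nu>) \<in> G \<Longrightarrow> x \<noteq> 0 \<Longrightarrow> Re \<nu> \<le> B"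
  shows "uq_module q V"
proof -
  note ws = weight_space_span[OF lin(3) H span]
  have V: "weight_spanned V"
    by (rule weight_spannedI[OF lin(3) H span])
  have dec: "\<exists>!d. (\<forall>\<nu>. Poly_Mapping.lookup d \<nu> \<in> weight_space V \<nu>)
      \<and> v = (\<Sum>\<nu>\<in>Poly_Mapping.keys d. Poly_Mapping.lookup d \<nu>)" for v
    using weight_decomp_exists[OF V, of v] weight_decomp_unique[OF lin(3), of v]
    unfolding weight_decomp_def[symmetric] by blast
  have e: "opE V v \<in> weight_space V (\<nu> + 2)" if "v \<in> weight_space V \<nu>" for v \<nu>
  proof -
    have "opE V v \<in> cvec.span (weight_space V (\<nu> + 2))"
      by (rule clinear_in_span[OF lin(1) ws[OF _ that]]) (auto intro: E cvec.span_base)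
    then show ?thesis
      using subspace_weight_space[OF lin(3)] by (simp add: cvec.span_eq_iff[THEN iffD2])
  qed
  have f: "opF V v \<in> weight_space V (\<nu> - 2)" if "v \<in> weight_space V \<nu>" for v \<nu>
  proof -
    have "opF V v \<in> cvec.span (weight_space V (\<nu> - 2))"
      by (rule clinear_in_span[OF lin(2) ws[OF _ that]]) (auto intro: F cvec.span_base)
    then show ?thesis
      using subspace_weight_space[OF lin(3)] by (simp add: cvec.span_eq_iff[THEN iffD2])
  qed
  have ef: "opE V (opF V v) - opF V (opE V v) = qnum q \<nu> *\<^sub>C v"
    if "v \<in> weight_space V \<nu>" for v \<nu>
  proof (rule clinear_eq_on_span[OF _ _ ws[OF _ that]])
    show "clinear (\<lambda>v. opE V (opF V v) - opF V (opE V v))"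
      by (rule clinearI) (simp_all add: clinear_add[OF lin(1)] clinear_add[OF lin(2)]
          clinear_scale[OF lin(1)] clinear_scale[OF lin(2)] cvec.scale_right_diff_distrib)
    show "clinear ((*\<^sub>C) (qnum q \<nu>))"
      by (rule clinear_scaleC[OF clinear_id])
  qed (auto intro: EF)
  have bound: "Re \<nu> \<le> B" if ne: "weight_space V \<nu> \<noteq> {0}" for \<nu>
  proof (rule ccontr)
    assume "\<not> Re \<nu> \<le> B"
    with bd have "{x. (x, \<nu>) \<in> G} \<subseteq> {0}" by blast
    then have "cvec.span {x. (x, \<nu>) \<in> G} \<subseteq> {0}"
      using cvec.span_minimal[OF _ cvec.subspace_single_0] by blast
    then have "weight_space V \<nu> \<subseteq> {0}"
      using ws by blast
    with ne show False
      using cvec.subspace_0[OF subspace_weight_space[OF lin(3), of \<nu>]] by blast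
  qed
  have "\<forall>\<nu>. opE V ` weight_space V \<nu> \<subseteq> weight_space V (\<nu> + 2)"
    "\<forall>\<nu>. opF V ` weight_space V \<nu> \<subseteq> weight_space V (\<nu> - 2)"
    "\<forall>\<nu>. \<forall>v\<in>weight_space V \<nu>. opE V (opF V v) - opF V (opE V v) = qnum q \<nu> *\<^sub>C v"
    "\<exists>B. \<forall>\<nu>. weight_space V \<nu> \<noteq> {0} \<longrightarrow> Re \<nu> \<le> B"
    using e f ef bound by blast+
  with lin dec show ?thesis
    unfolding uq_module_def by (intro conjI) (assumption | rule allI)+
qed

lemma opE_funpow_weight:
  assumes "uq_module q V" "v \<in> weight_space V \<nu>"
  shows "(opE V ^^ n) v \<in> weight_space V (\<nu> + 2 * of_nat n)"
proof (induction n)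
  case (Suc n)
  from opE_weight[OF assms(1) this] show ?case by (simp add: algebra_simps)
qed (use assms in simp)

lemma opF_funpow_weight:
  assumes "uq_module q V" "v \<in> weight_space V \<nu>"
  shows "(opF V ^^ n) v \<in> weight_space V (\<nu> - 2 * of_nat n)"
proof (induction n)
  case (Suc n)
  from opF_weight[OF assms(1) this] show ?case by (simp add: algebra_simps)
qed (use assms in simp)

lemma opE_nilpotent:
  assumes V: "uq_module q V" and v: "v \<in> weight_space V \<nu>"
  shows "\<exists>N. \<forall>n\<ge>N. (opE V ^^ n) v = 0"
proof -
  obtain B where B: "\<And>\<nu>. weight_space V \<nu> \<noteq> {0} \<Longrightarrow> Re \<nu> \<le> B"
    using weights_bounded[OF V] by blast
  obtain N :: nat where N: "B - Re \<nu> < of_nat N" using reals_Archimedean2 by blast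
  have "(opE V ^^ n) v = 0" if "n \<ge> N" for n
  proof (rule ccontr)
    assume "(opE V ^^ n) v \<noteq> 0"
    then have "weight_space V (\<nu> + 2 * of_nat n) \<noteq> {0}"
      using opE_funpow_weight[OF V v, of n] by blast
    from B[OF this] have "Re \<nu> + 2 * real n \<le> B" by simp
    with N that show False by linarith
  qed
  then show ?thesis by blast
qed

lemma opE_fun_h_nilpotent:
  assumes V: "uq_module q V"
  shows "\<exists>N. \<forall>n\<ge>N. \<forall>g. (opE V ^^ n) (fun_h V g v) = 0"
proof -
  note sp = uq_module_weight_spanned[OF V]
  note lin = clinear_compose[OF clinear_funpow[OF clinear_opE[OF V]] clinear_fun_h[OF sp]]
  have "v \<in> cvec.span (\<Union>\<nu>. weight_space V \<nu>)"
    using sp by (simp add: weight_spanned_def)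
  then show ?thesis
  proof (induction rule: cvec.span_induct_alt)
    case base
    show ?case by (simp only: clinear_0[OF lin]) simp
  next
    case (step c x y)
    then obtain \<nu> N M where x: "x \<in> weight_space V \<nu>"
      and N: "\<And>n g. n \<ge> N \<Longrightarrow> (opE V ^^ n) (fun_h V g y) = 0"
      and M: "\<And>n. n \<ge> M \<Longrightarrow> (opE V ^^ n) x = 0"
      using opE_nilpotent[OF V] by blast
    have "(opE V ^^ n) (fun_h V g x) = 0" if "n \<ge> M" for n g
      by (simp add: fun_h_weight[OF sp x] clinear_scale[OF clinear_funpow[OF clinear_opE[OF V]]] M that)
    with N show ?case
      by (intro exI[of _ "max N M"]) (simp only: clinear_add[OF lin] clinear_scale[OF lin], simp)
  qed
qed

lemma wt_eqI:
  assumes "v \<in> weight_space V \<nu>" "v \<noteq> 0"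
  shows "wt V v = \<nu>"
  unfolding wt_def using assms by (intro the_equality) (auto simp: weight_space_iff)

lemma intertwining_fun_h:
  assumes V: "weight_spanned V" and U: "weight_spanned U" and T: "intertwining V U T"
  shows "T (fun_h V g v) = fun_h U g (T v)"
proof -
  have lin: "clinear T" using T by (simp add: intertwining_def)
  have "(\<lambda>v. T (fun_h V g v)) = (\<lambda>v. fun_h U g (T v))"
  proof (rule weight_spanned_eqI[OF V])
    fix \<nu> x assume x: "x \<in> weight_space V \<nu>"
    have "T (opH V x) = opH U (T x)"
      using T by (simp add: intertwining_def)
    with x have "T x \<in> weight_space U \<nu>"
      by (simp add: weight_space_iff clinear_scale[OF lin])
    then show "T (fun_h V g x) = fun_h U g (T x)"
      by (simp add: fun_h_weight[OF V x] fun_h_weight[OF U] clinear_scale[OF lin])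
  qed (rule clinear_compose[OF lin clinear_fun_h[OF V]]
        clinear_compose[OF clinear_fun_h[OF U] lin])+
  then show ?thesis by (rule fun_cong)
qed

section \<open>Quantum numbers\<close>

lemma qpow_add: "qpow q (a + b) = qpow q a * qpow q b"
  by (simp add: qpow_def distrib_right exp_add)

lemma qpow_0 [simp]: "qpow q 0 = 1"
  by (simp add: qpow_def)

lemma qpow_nonzero [simp]: "qpow q a \<noteq> 0"
  by (simp add: qpow_def)

lemma qpow_minus: "qpow q (- a) = inverse (qpow q a)"
  by (simp add: qpow_def exp_minus)

lemma qpow_diff: "qpow q (a - b) = qpow q a / qpow q b"
  by (simp add: qpow_def left_diff_distrib exp_diff)

lemma qpow_of_nat_mult: "qpow q (of_nat n * a) = qpow q a ^ n"
  by (simp add: qpow_def mult.assoc exp_of_nat_mult)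

lemma qpow_eq_1D:
  assumes "0 < q" "q < 1" "qpow q a = 1"
  shows "\<exists>m::int. a = of_int m * (2 * of_real pi * \<i> / of_real (ln q))"
proof -
  define L where "L = ln q"
  have L: "L \<noteq> 0" using assms(1,2) by (simp add: L_def)
  let ?z = "a * of_real L"
  have z: "exp ?z = 1" using assms(3) by (simp add: qpow_def L_def)
  then have "norm (exp ?z) = 1" by simp
  then have Re: "Re ?z = 0" by simp
  have "Re (exp ?z) = 1" using z by simp
  then have "cos (Im ?z) = 1" unfolding Re_exp Re by simp
  then obtain m :: int where "Im ?z = of_int m * 2 * pi"
    using cos_one_2pi_int by auto
  with Re have "?z = of_int m * (2 * of_real pi * \<i>)"
    by (auto simp: complex_eq_iff)
  with L have "a = of_int m * (2 * of_real pi * \<i> / of_real L)"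
    by (simp add: field_simps)
  then show ?thesis unfolding L_def ..
qed

lemma qpow_half_diff_nonzero:
  assumes "0 < q" "q < 1"
  shows "qpow q (1 / 2) - qpow q (- 1 / 2) \<noteq> 0"
proof
  assume "qpow q (1 / 2) - qpow q (- 1 / 2) = 0"
  then have "qpow q (1 / 2) * qpow q (1 / 2) = qpow q (- 1 / 2) * qpow q (1 / 2)"
    by simp
  then have "qpow q 1 = 1"
    by (simp flip: qpow_add)
  then obtain m :: int where "1 = of_int m * (2 * of_real pi * \<i> / of_real (ln q))"
    using qpow_eq_1D[OF assms] by blast
  then have "Re 1 = Re (of_int m * (2 * of_real pi * \<i> / of_real (ln q)))" by (rule arg_cong)
  then show False by (simp add: Re_divide)
qed

lemma qnum_eq_0D:
  assumes "0 < q" "q < 1" "qnum q a = 0"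
  shows "\<exists>m::int. a = of_int m * (2 * of_real pi * \<i> / of_real (ln q))"
proof (rule qpow_eq_1D[OF assms(1,2)])
  have "qpow q (a / 2) = qpow q (- a / 2)"
    using assms(3) qpow_half_diff_nonzero[OF assms(1,2)] by (simp add: qnum_def)
  then have "qpow q (a / 2) * qpow q (a / 2) = qpow q (- a / 2) * qpow q (a / 2)"
    by simp
  then show "qpow q a = 1"
    by (simp flip: qpow_add)
qed

lemma qnum_of_nat_nonzero:
  assumes "0 < q" "q < 1" "k > 0"
  shows "qnum q (of_nat k) \<noteq> 0"
proof
  assume "qnum q (of_nat k) = 0"
  then obtain m :: int where "of_nat k = of_int m * (2 * of_real pi * \<i> / of_real (ln q))"
    using qnum_eq_0D[OF assms(1,2)] by blast
  then have "Re (of_nat k) = Re (of_int m * (2 * of_real pi * \<i> / of_real (ln q)))"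
    by (rule arg_cong)
  with assms(3) show False by (simp add: Re_divide)
qed

lemma generic_qnum_nonzero:
  assumes "0 < q" "q < 1" "generic q \<mu>"
  shows "qnum q (\<mu> - of_nat k) \<noteq> 0"
proof
  assume "qnum q (\<mu> - of_nat k) = 0"
  then obtain m :: int where "\<mu> - of_nat k = of_int m * (2 * of_real pi * \<i> / of_real (ln q))"
    using qnum_eq_0D[OF assms(1,2)] by blast
  then have "\<mu> = of_nat k + of_int m * (2 * of_real pi * \<i> / of_real (ln q))"
    by (simp add: algebra_simps)
  with assms(3) show False unfolding generic_def by blast
qed

lemma qnum_0 [simp]: "qnum q 0 = 0"
  by (simp add: qnum_def)

lemma qnum_minus: "qnum q (- a) = - qnum q a"
proof -
  have "qpow q (- a / 2) - qpow q (- (- a) / 2) = - (qpow q (a / 2) - qpow q (- a / 2))"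
    by simp
  then show ?thesis
    by (simp only: qnum_def minus_divide_left)
qed

lemma qnum_add: "qnum q (a + b) = qnum q a * qpow q (b / 2) + qpow q (- a / 2) * qnum q b"
proof -
  have "qpow q ((a + b) / 2) - qpow q (- (a + b) / 2)
      = (qpow q (a / 2) - qpow q (- a / 2)) * qpow q (b / 2)
        + qpow q (- a / 2) * (qpow q (b / 2) - qpow q (- b / 2))"
    by (simp add: algebra_simps diff_divide_distrib add_divide_distrib flip: qpow_add)
  then show ?thesis
    by (simp add: qnum_def add_divide_distrib)
qed

lemma qnum_mult_Suc_diff:
  assumes "0 < q" "q < 1"
  shows "qnum q (a + 1) * qnum q b - qnum q a * qnum q (b + 1) = qnum q (b - a)"
proof -
  define s where "s = qpow q (1 / 2)"
  define x where "x = qpow q (a / 2)"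
  define y where "y = qpow q (b / 2)"
  have nz: "s \<noteq> 0" "x \<noteq> 0" "y \<noteq> 0" by (simp_all add: s_def x_def y_def)
  have d: "s - inverse s \<noteq> 0"
    using qpow_half_diff_nonzero[OF assms] qpow_minus[of q "1 / 2"] by (simp add: s_def)
  have qnum: "qnum q c = (qpow q (c / 2) - inverse (qpow q (c / 2))) / (s - inverse s)" for c
    using qpow_minus[of q "1 / 2"] qpow_minus[of q "c / 2"] by (simp add: qnum_def s_def)
  have *: "qpow q ((a + 1) / 2) = x * s" "qpow q ((b + 1) / 2) = y * s" "qpow q ((b - a) / 2) = y / x"
    by (simp_all add: x_def y_def s_def add_divide_distrib diff_divide_distrib qpow_add qpow_diff)
  have "(A / D) * (B / D) - (C / D) * (E / D) = (A * B - C * E) / D / D" for A B C D E :: complex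
    by (simp add: diff_divide_distrib)
  then have lhs: "qnum q (a + 1) * qnum q b - qnum q a * qnum q (b + 1)
      = ((x * s - inverse (x * s)) * (y - inverse y) - (x - inverse x) * (y * s - inverse (y * s)))
        / (s - inverse s) / (s - inverse s)"
    unfolding qnum * x_def[symmetric] y_def[symmetric] .
  have rhs: "qnum q (b - a) = (y / x - x / y) / (s - inverse s)"
    unfolding qnum * by (simp only: inverse_divide)
  have "(x * s - inverse (x * s)) * (y - inverse y) - (x - inverse x) * (y * s - inverse (y * s))
      = (y / x - x / y) * (s - inverse s)"
    using nz by (simp add: field_simps)
  then show ?thesis
    unfolding lhs rhs using d by simp
qed

section \<open>Verma modules\<close>

lemma extend_linear_eq: "extend_linear = free_ext"
  by (simp add: fun_eq_iff extend_linear_def free_ext_def)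

lemma extend_linear_fx: "extend_linear g (fx k) = g k"
  by (simp add: extend_linear_eq fx_def free_ext_single)

lemma clinear_extend_linear: "clinear (extend_linear g)"
  by (simp add: extend_linear_eq clinear_free_ext)

lemma
  shows opE_verma: "opE (verma q \<Lambda>) (fx k)
      = (qnum q (of_nat k) * qnum q (\<Lambda> - of_nat k + 1)) *\<^sub>C fx (k - 1)"
    and opF_verma: "opF (verma q \<Lambda>) (fx k) = fx (Suc k)"
    and opH_verma: "opH (verma q \<Lambda>) (fx k) = (\<Lambda> - 2 * of_nat k) *\<^sub>C fx k"
  by (simp_all add: verma_def extend_linear_fx)

lemma span_fx: "cvec.span (range fx) = UNIV"
proof -
  have "p \<in> cvec.span (range fx)" for p
  proof -
    have "p = (\<Sum>k\<in>Poly_Mapping.keys p. Poly_Mapping.lookup p k *\<^sub>C fx k)"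
      using free_ext_single_id[of p] by (simp only: free_ext_def fx_def)
    moreover have "\<dots> \<in> cvec.span (range fx)"
      by (rule cvec.span_sum, rule cvec.span_scale, rule cvec.span_base, rule rangeI)
    ultimately show ?thesis by (rule ssubst)
  qed
  then show ?thesis by blast
qed

lemma fx_weight: "fx k \<in> weight_space (verma q \<Lambda>) (\<Lambda> - 2 * of_nat k)"
  by (simp add: weight_space_iff opH_verma)

lemma uq_module_verma:
  assumes "0 < q" "q < 1"
  shows "uq_module q (verma q \<Lambda>)"
proof -
  let ?V = "verma q \<Lambda>" and ?G = "range (\<lambda>k. (fx k, \<Lambda> - 2 * of_nat k))"
  have lin: "clinear (opE ?V)" "clinear (opF ?V)" "clinear (opH ?V)"
    by (simp_all add: verma_def clinear_extend_linear)
  have ws: "cvec.subspace (weight_space ?V \<nu>)" for \<nu>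
    by (rule subspace_weight_space[OF lin(3)])
  show ?thesis
  proof (rule uq_moduleI[OF lin, where G = ?G and B = "Re \<Lambda>"])
    show "cvec.span (fst ` ?G) = UNIV"
      by (simp add: image_image span_fx)
    fix x \<nu> assume "(x, \<nu>) \<in> ?G"
    then obtain k where [simp]: "x = fx k" "\<nu> = \<Lambda> - 2 * of_nat k" by auto
    show "x \<in> weight_space ?V \<nu>" by (simp add: fx_weight)
    show "opE ?V x \<in> weight_space ?V (\<nu> + 2)"
    proof (cases k)
      case 0
      then show ?thesis by (simp add: opE_verma cvec.subspace_0[OF ws])
    next
      case (Suc j)
      then show ?thesis
        using cvec.subspace_scale[OF ws fx_weight[of j q \<Lambda>]]
        by (simp add: opE_verma algebra_simps)
    qed
    show "opF ?V x \<in> weight_space ?V (\<nu> - 2)"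
      using fx_weight[of "Suc k" q \<Lambda>] by (simp add: opF_verma algebra_simps)
    have "opE ?V (opF ?V x) - opF ?V (opE ?V x)
        = (qnum q (of_nat k + 1) * qnum q (\<Lambda> - of_nat k)
           - qnum q (of_nat k) * qnum q (\<Lambda> - of_nat k + 1)) *\<^sub>C fx k"
      by (cases k) (simp_all add: opE_verma opF_verma clinear_scale[OF lin(2)]
          clinear_0[OF lin(2)] cvec.scale_left_diff_distrib algebra_simps)
    also have "\<dots> = qnum q \<nu> *\<^sub>C x"
      unfolding qnum_mult_Suc_diff[OF assms] by (simp add: algebra_simps)
    finally show "opE ?V (opF ?V x) - opF ?V (opE ?V x) = qnum q \<nu> *\<^sub>C x" .
    show "Re \<nu> \<le> Re \<Lambda>" by simp
  qed
qed

section \<open>Tensor product modules\<close>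

lemma tens_in_span:
  assumes "a \<in> cvec.span A" "b \<in> cvec.span B"
  shows "a \<otimes> b \<in> cvec.span {x \<otimes> y | x y. x \<in> A \<and> y \<in> B}"
  by (rule clinear_in_span[OF clinear_tens_left assms(1)],
      rule clinear_in_span[OF clinear_tens_right assms(2)],
      rule cvec.span_base, blast)

lemma span_weight_tensors:
  assumes "weight_spanned V" "weight_spanned W"
  shows "t \<in> cvec.span {x \<otimes> y | x y. (\<exists>\<alpha>. x \<in> weight_space V \<alpha>) \<and> (\<exists>\<beta>. y \<in> weight_space W \<beta>)}"
proof (induction t rule: tensor_induct)
  case (tens a b)
  have "a \<in> cvec.span {x. \<exists>\<alpha>. x \<in> weight_space V \<alpha>}" "b \<in> cvec.span {y. \<exists>\<beta>. y \<in> weight_space W \<beta>}"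
    using assms unfolding weight_spanned_def UNION_eq by simp_all
  from tens_in_span[OF this] show ?case by simp
qed (rule cvec.span_add)

lemma weight_tensor_eqI:
  assumes V: "weight_spanned V" and W: "weight_spanned W" and lin: "clinear f" "clinear g"
    and eq: "\<And>x y \<alpha> \<beta>. x \<in> weight_space V \<alpha> \<Longrightarrow> y \<in> weight_space W \<beta> \<Longrightarrow> f (x \<otimes> y) = g (x \<otimes> y)"
  shows "f = g"
proof
  fix t
  show "f t = g t"
    by (rule clinear_eq_on_span[OF lin span_weight_tensors[OF V W]]) (auto intro: eq)
qed

definition coprod :: "real \<Rightarrow> ('v::complex_vector) uq_ops \<Rightarrow> ('w::complex_vector) uq_ops
    \<Rightarrow> ('v \<Rightarrow> 'v) \<Rightarrow> ('w \<Rightarrow> 'w) \<Rightarrow> ('v, 'w) tensor \<Rightarrow> ('v, 'w) tensor"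
  where "coprod q V W S T t = tensor_map S (fun_h W (\<lambda>z. qpow q (z / 4))) t
    + tensor_map (fun_h V (\<lambda>z. qpow q (- z / 4))) T t"

lemma opE_tensor: "opE (tensor_module q V W) = coprod q V W (opE V) (opE W)"
  and opF_tensor: "opF (tensor_module q V W) = coprod q V W (opF V) (opF W)"
  by (simp_all add: tensor_module_def coprod_def fun_eq_iff)

lemma
  assumes V: "weight_spanned V" and W: "weight_spanned W" and lin: "clinear S" "clinear T"
  shows clinear_coprod: "clinear (coprod q V W S T)"
    and coprod_tens: "coprod q V W S T (a \<otimes> b) =
      S a \<otimes> fun_h W (\<lambda>z. qpow q (z / 4)) b + fun_h V (\<lambda>z. qpow q (- z / 4)) a \<otimes> T b"
    and coprod_weight: "x \<in> weight_space V \<alpha> \<Longrightarrow> y \<in> weight_space W \<beta> \<Longrightarrow>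
      coprod q V W S T (x \<otimes> y) =
      qpow q (\<beta> / 4) *\<^sub>C (S x \<otimes> y) + qpow q (- \<alpha> / 4) *\<^sub>C (x \<otimes> T y)"
proof -
  show "clinear (coprod q V W S T)"
    using clinear_plus[OF clinear_tensor_map[OF lin(1) clinear_fun_h[OF W]]
        clinear_tensor_map[OF clinear_fun_h[OF V] lin(2)]]
    by (simp add: coprod_def[abs_def])
  show tens: "coprod q V W S T (a \<otimes> b) =
      S a \<otimes> fun_h W (\<lambda>z. qpow q (z / 4)) b + fun_h V (\<lambda>z. qpow q (- z / 4)) a \<otimes> T b" for a b
    by (simp only: coprod_def tensor_map_tens[OF lin(1) clinear_fun_h[OF W]]
        tensor_map_tens[OF clinear_fun_h[OF V] lin(2)])
  show "coprod q V W S T (x \<otimes> y) =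
      qpow q (\<beta> / 4) *\<^sub>C (S x \<otimes> y) + qpow q (- \<alpha> / 4) *\<^sub>C (x \<otimes> T y)"
    if "x \<in> weight_space V \<alpha>" "y \<in> weight_space W \<beta>"
    by (simp add: tens fun_h_weight[OF V that(1)] fun_h_weight[OF W that(2)]
        tens_scale_left tens_scale_right)
qed

lemma
  assumes "clinear (opH V)" "clinear (opH W)"
  shows clinear_opH_tensor: "clinear (opH (tensor_module q V W))"
    and opH_tens: "opH (tensor_module q V W) (a \<otimes> b) = opH V a \<otimes> b + a \<otimes> opH W b"
proof -
  note tm = clinear_tensor_map[OF assms(1) clinear_id'] clinear_tensor_map[OF clinear_id' assms(2)]
  show "clinear (opH (tensor_module q V W))"
    using clinear_plus[OF tm] by (simp only: tensor_module_def uq_ops.simps)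
  show "opH (tensor_module q V W) (a \<otimes> b) = opH V a \<otimes> b + a \<otimes> opH W b"
    by (simp only: tensor_module_def uq_ops.simps tensor_map_tens[OF assms(1) clinear_id']
        tensor_map_tens[OF clinear_id' assms(2)] id_apply)
qed

lemma tens_weight:
  assumes "clinear (opH V)" "clinear (opH W)"
    and "x \<in> weight_space V \<alpha>" "y \<in> weight_space W \<beta>"
  shows "x \<otimes> y \<in> weight_space (tensor_module q V W) (\<alpha> + \<beta>)"
  using assms(3,4)
  by (simp add: weight_space_iff opH_tens[OF assms(1,2)] tens_scale_left tens_scale_right
      cvec.scale_left_distrib)

lemma uq_module_tensor:
  assumes V: "uq_module q V" and W: "uq_module q W"
  shows "uq_module q (tensor_module q V W)"
proof -
  let ?T = "tensor_module q V W"
  let ?G = "{(x \<otimes> y, \<alpha> + \<beta>) | x y \<alpha> \<beta>. x \<in> weight_space V \<alpha> \<and> y \<in> weight_space W \<beta>}"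
  note sV = uq_module_weight_spanned[OF V] and sW = uq_module_weight_spanned[OF W]
  have lin: "clinear (opE ?T)" "clinear (opF ?T)" "clinear (opH ?T)"
    unfolding opE_tensor opF_tensor
    by (rule clinear_coprod[OF sV sW clinear_opE[OF V] clinear_opE[OF W]]
        clinear_coprod[OF sV sW clinear_opF[OF V] clinear_opF[OF W]]
        clinear_opH_tensor[OF clinear_opH[OF V] clinear_opH[OF W]])+
  have ws: "cvec.subspace (weight_space ?T \<nu>)" for \<nu>
    by (rule subspace_weight_space[OF lin(3)])
  obtain B C where B: "\<And>\<nu>. weight_space V \<nu> \<noteq> {0} \<Longrightarrow> Re \<nu> \<le> B"
    and C: "\<And>\<nu>. weight_space W \<nu> \<noteq> {0} \<Longrightarrow> Re \<nu> \<le> C"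
    using weights_bounded[OF V] weights_bounded[OF W] by blast
  note E = coprod_weight[OF sV sW clinear_opE[OF V] clinear_opE[OF W]]
  note F = coprod_weight[OF sV sW clinear_opF[OF V] clinear_opF[OF W]]
  note tw = tens_weight[OF clinear_opH[OF V] clinear_opH[OF W]]
  show ?thesis
  proof (rule uq_moduleI[OF lin, where G = ?G and B = "B + C"])
    have *: "fst ` ?G = {x \<otimes> y | x y. (\<exists>\<alpha>. x \<in> weight_space V \<alpha>) \<and> (\<exists>\<beta>. y \<in> weight_space W \<beta>)}"
      by force
    have "t \<in> cvec.span (fst ` ?G)" for t
      unfolding * by (rule span_weight_tensors[OF sV sW])
    then show "cvec.span (fst ` ?G) = UNIV" by blast
    fix z \<nu> assume "(z, \<nu>) \<in> ?G"
    then obtain x y \<alpha> \<beta> where z: "z = x \<otimes> y" and \<nu>: "\<nu> = \<alpha> + \<beta>"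
      and x: "x \<in> weight_space V \<alpha>" and y: "y \<in> weight_space W \<beta>" by blast
    note Ex = opE_weight[OF V x] and Ey = opE_weight[OF W y]
      and Fx = opF_weight[OF V x] and Fy = opF_weight[OF W y]
    show "z \<in> weight_space ?T \<nu>"
      unfolding z \<nu> by (rule tw[OF x y])
    have "opE V x \<otimes> y \<in> weight_space ?T (\<nu> + 2)" "x \<otimes> opE W y \<in> weight_space ?T (\<nu> + 2)"
      using tw[OF Ex y, of q] tw[OF x Ey, of q] by (simp_all add: \<nu> algebra_simps)
    then show "opE ?T z \<in> weight_space ?T (\<nu> + 2)"
      unfolding z opE_tensor E[OF x y]
      by (intro cvec.subspace_add[OF ws] cvec.subspace_scale[OF ws])
    have "opF V x \<otimes> y \<in> weight_space ?T (\<nu> - 2)" "x \<otimes> opF W y \<in> weight_space ?T (\<nu> - 2)"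
      using tw[OF Fx y, of q] tw[OF x Fy, of q] by (simp_all add: \<nu> algebra_simps)
    then show "opF ?T z \<in> weight_space ?T (\<nu> - 2)"
      unfolding z opF_tensor F[OF x y]
      by (intro cvec.subspace_add[OF ws] cvec.subspace_scale[OF ws])
    have EFx: "opE V (opF V x) = opF V (opE V x) + qnum q \<alpha> *\<^sub>C x"
      using opE_opF[OF V x] by (simp add: algebra_simps)
    have EFy: "opE W (opF W y) = opF W (opE W y) + qnum q \<beta> *\<^sub>C y"
      using opE_opF[OF W y] by (simp add: algebra_simps)
    have c1: "qpow q (\<beta> / 4) * qpow q (- (\<alpha> - 2) / 4) = qpow q (- \<alpha> / 4) * qpow q ((\<beta> + 2) / 4)"
      and c2: "qpow q (- \<alpha> / 4) * qpow q ((\<beta> - 2) / 4) = qpow q (\<beta> / 4) * qpow q (- (\<alpha> + 2) / 4)"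
      by (simp_all add: algebra_simps diff_divide_distrib add_divide_distrib flip: qpow_add)
    have c3: "qpow q (\<beta> / 4) * qpow q (\<beta> / 4) = qpow q (\<beta> / 2)"
      and c4: "qpow q (- \<alpha> / 4) * qpow q (- \<alpha> / 4) = qpow q (- \<alpha> / 2)"
      by (simp_all flip: qpow_add)
    have EF: "opE ?T (opF ?T z) = qpow q (\<beta> / 2) *\<^sub>C (opE V (opF V x) \<otimes> y)
        + (qpow q (\<beta> / 4) * qpow q (- (\<alpha> - 2) / 4)) *\<^sub>C (opF V x \<otimes> opE W y)
        + (qpow q (- \<alpha> / 4) * qpow q ((\<beta> - 2) / 4)) *\<^sub>C (opE V x \<otimes> opF W y)
        + qpow q (- \<alpha> / 2) *\<^sub>C (x \<otimes> opE W (opF W y))"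
      unfolding z opF_tensor F[OF x y] clinear_add[OF lin(1)] clinear_scale[OF lin(1)]
      unfolding opE_tensor E[OF Fx y] E[OF x Fy]
      by (simp only: cvec.scale_right_distrib scaleC_scaleC c3 c4 add.assoc)
    have FE: "opF ?T (opE ?T z) = qpow q (\<beta> / 2) *\<^sub>C (opF V (opE V x) \<otimes> y)
        + (qpow q (\<beta> / 4) * qpow q (- (\<alpha> + 2) / 4)) *\<^sub>C (opE V x \<otimes> opF W y)
        + (qpow q (- \<alpha> / 4) * qpow q ((\<beta> + 2) / 4)) *\<^sub>C (opF V x \<otimes> opE W y)
        + qpow q (- \<alpha> / 2) *\<^sub>C (x \<otimes> opF W (opE W y))"
      unfolding z opE_tensor E[OF x y] clinear_add[OF lin(2)] clinear_scale[OF lin(2)]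
      unfolding opF_tensor F[OF Ex y] F[OF x Ey]
      by (simp only: cvec.scale_right_distrib scaleC_scaleC c3 c4 add.assoc)
    have "opE ?T (opF ?T z) - opF ?T (opE ?T z)
        = (qnum q \<alpha> * qpow q (\<beta> / 2) + qpow q (- \<alpha> / 2) * qnum q \<beta>) *\<^sub>C (x \<otimes> y)"
      unfolding EF FE c1 c2 EFx EFy
      by (simp add: tens_add_left tens_add_right tens_scale_left tens_scale_right
          cvec.scale_right_distrib cvec.scale_left_distrib scaleC_scaleC mult.commute)
    then show "opE ?T (opF ?T z) - opF ?T (opE ?T z) = qnum q \<nu> *\<^sub>C z"
      unfolding z \<nu> qnum_add .
    assume "z \<noteq> 0"
    then have "x \<noteq> 0" "y \<noteq> 0" unfolding z by auto
    with x y have "weight_space V \<alpha> \<noteq> {0}" "weight_space W \<beta> \<noteq> {0}" by auto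
    from B[OF this(1)] C[OF this(2)] show "Re \<nu> \<le> B + C"
      unfolding \<nu> by simp
  qed
qed

section \<open>Intertwining maps\<close>

lemma tensor_map_id_tens: "clinear T \<Longrightarrow> tensor_map T id (a \<otimes> b) = T a \<otimes> b"
  using tensor_map_tens[OF _ clinear_id', of T a b] by simp

lemma intertwiningD:
  assumes "intertwining V W T"
  shows "clinear T" "T (opE V x) = opE W (T x)" "T (opF V x) = opF W (T x)"
    "T (opH V x) = opH W (T x)"
  using assms by (simp_all add: intertwining_def)

lemma intertwining_compose:
  assumes "intertwining U V S" "intertwining V W T"
  shows "intertwining U W (T \<circ> S)"
  unfolding intertwining_def comp_def
  using clinear_compose[OF intertwiningD(1)[OF assms(2)] intertwiningD(1)[OF assms(1)]]
  by (simp add: intertwiningD(2-4)[OF assms(1)] intertwiningD(2-4)[OF assms(2)])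

lemma intertwining_tensor_map:
  assumes M: "uq_module q M" and N: "uq_module q N" and V: "uq_module q V"
    and T: "intertwining M N T"
  shows "intertwining (tensor_module q M V) (tensor_module q N V) (tensor_map T id)"
proof -
  note sM = uq_module_weight_spanned[OF M] and sN = uq_module_weight_spanned[OF N]
    and sV = uq_module_weight_spanned[OF V]
  note T' = intertwiningD[OF T]
  note lin = clinear_tensor_map[OF T'(1) clinear_id'] and tm = tensor_map_id_tens[OF T'(1)]
  have coprod: "tensor_map T id (coprod q M V S R t) = coprod q N V S' R (tensor_map T id t)"
    if S: "clinear S" "clinear S'" "clinear R" "\<And>x. T (S x) = S' (T x)" for S S' R t
  proof (induction t rule: tensor_induct)
    case (tens a b)
    show ?case
      by (simp only: coprod_tens[OF sM sV S(1,3)] clinear_add[OF lin] tm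
          coprod_tens[OF sN sV S(2,3)] S(4) intertwining_fun_h[OF sM sN T])
  next
    case (add s t)
    then show ?case
      by (simp only: clinear_add[OF clinear_coprod[OF sM sV S(1,3)]] clinear_add[OF lin]
          clinear_add[OF clinear_coprod[OF sN sV S(2,3)]])
  qed
  have H: "tensor_map T id (opH (tensor_module q M V) t)
      = opH (tensor_module q N V) (tensor_map T id t)" for t
  proof (induction t rule: tensor_induct)
    case (tens a b)
    show ?case
      by (simp only: opH_tens[OF clinear_opH[OF M] clinear_opH[OF V]] tm clinear_add[OF lin]
          opH_tens[OF clinear_opH[OF N] clinear_opH[OF V]] T'(4))
  next
    case (add s t)
    then show ?case
      by (simp only: clinear_add[OF clinear_opH_tensor[OF clinear_opH[OF M] clinear_opH[OF V]]]
          clinear_add[OF clinear_opH_tensor[OF clinear_opH[OF N] clinear_opH[OF V]]]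
          clinear_add[OF lin])
  qed
  show ?thesis
    unfolding intertwining_def opE_tensor opF_tensor
    using lin coprod[OF clinear_opE[OF M] clinear_opE[OF N] clinear_opE[OF V] T'(2)]
      coprod[OF clinear_opF[OF M] clinear_opF[OF N] clinear_opF[OF V] T'(3)] H
    by (intro conjI allI)
qed

lemma intertwining_tensor_assoc:
  assumes A: "uq_module q A" and B: "uq_module q B" and C: "uq_module q C"
  shows "intertwining (tensor_module q (tensor_module q A B) C)
    (tensor_module q A (tensor_module q B C)) tensor_assoc"
proof -
  let ?AB = "tensor_module q A B" and ?BC = "tensor_module q B C"
  note AB = uq_module_tensor[OF A B] and BC = uq_module_tensor[OF B C]
  note sA = uq_module_weight_spanned[OF A] and sB = uq_module_weight_spanned[OF B]
    and sC = uq_module_weight_spanned[OF C] and sAB = uq_module_weight_spanned[OF AB]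
    and sBC = uq_module_weight_spanned[OF BC]
  note hA = clinear_opH[OF A] and hB = clinear_opH[OF B] and hC = clinear_opH[OF C]
    and hAB = clinear_opH[OF AB] and hBC = clinear_opH[OF BC]
  have triple: "f = g" if lin: "clinear f" "clinear g"
    and eq: "\<And>x y z \<alpha> \<beta> \<gamma>. x \<in> weight_space A \<alpha> \<Longrightarrow> y \<in> weight_space B \<beta>
      \<Longrightarrow> z \<in> weight_space C \<gamma> \<Longrightarrow> f ((x \<otimes> y) \<otimes> z) = g ((x \<otimes> y) \<otimes> z)"
    for f g :: "(('a, 'b) tensor, 'c) tensor \<Rightarrow> ('a, ('b, 'c) tensor) tensor"
  proof (rule weight_tensor_eqI[OF sAB sC lin])
    fix t z \<tau> \<gamma> assume z: "z \<in> weight_space C \<gamma>"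
    have "(\<lambda>t. f (t \<otimes> z)) = (\<lambda>t. g (t \<otimes> z))"
      by (rule weight_tensor_eqI[OF sA sB clinear_compose[OF lin(1) clinear_tens_left]
            clinear_compose[OF lin(2) clinear_tens_left]]) (rule eq[OF _ _ z])
    then show "f (t \<otimes> z) = g (t \<otimes> z)" by (rule fun_cong)
  qed
  have coprod: "(\<lambda>t. tensor_assoc (coprod q ?AB C (coprod q A B R S) T t))
      = (\<lambda>t. coprod q A ?BC R (coprod q B C S T) (tensor_assoc t))"
    if R: "clinear R" and S: "clinear S" and T: "clinear T" for R S T
  proof -
    note cAB = clinear_coprod[OF sA sB R S, of q] and cBC = clinear_coprod[OF sB sC S T, of q]
    note wAB = coprod_weight[OF sA sB R S] and wBC = coprod_weight[OF sB sC S T]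
    show ?thesis
    proof (rule triple)
      show "clinear (\<lambda>t. tensor_assoc (coprod q ?AB C (coprod q A B R S) T t))"
        by (rule clinear_compose[OF clinear_tensor_assoc clinear_coprod[OF sAB sC cAB T]])
      show "clinear (\<lambda>t. coprod q A ?BC R (coprod q B C S T) (tensor_assoc t))"
        by (rule clinear_compose[OF clinear_coprod[OF sA sBC R cBC] clinear_tensor_assoc])
      fix x y z \<alpha> \<beta> \<gamma>
      assume x: "x \<in> weight_space A \<alpha>" and y: "y \<in> weight_space B \<beta>"
        and z: "z \<in> weight_space C \<gamma>"
      have q: "qpow q (\<gamma> / 4) * qpow q (\<beta> / 4) = qpow q ((\<beta> + \<gamma>) / 4)"
        "qpow q (\<gamma> / 4) * qpow q (- \<alpha> / 4) = qpow q (- \<alpha> / 4) * qpow q (\<gamma> / 4)"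
        "qpow q (- (\<alpha> + \<beta>) / 4) = qpow q (- \<alpha> / 4) * qpow q (- \<beta> / 4)"
        by (simp_all add: add_divide_distrib diff_divide_distrib algebra_simps flip: qpow_add)
      show "tensor_assoc (coprod q ?AB C (coprod q A B R S) T ((x \<otimes> y) \<otimes> z))
          = coprod q A ?BC R (coprod q B C S T) (tensor_assoc ((x \<otimes> y) \<otimes> z))"
        unfolding tensor_assoc_tens coprod_weight[OF sAB sC cAB T tens_weight[OF hA hB x y] z]
          coprod_weight[OF sA sBC R cBC x tens_weight[OF hB hC y z]] wAB[OF x y] wBC[OF y z]
        by (simp only: tens_add_left tens_add_right tens_scale_left tens_scale_right
            clinear_add[OF clinear_tensor_assoc] clinear_scale[OF clinear_tensor_assoc]
            tensor_assoc_tens cvec.scale_right_distrib scaleC_scaleC q add.assoc)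
    qed
  qed
  have H: "(\<lambda>t. tensor_assoc (opH (tensor_module q ?AB C) t))
      = (\<lambda>t. opH (tensor_module q A ?BC) (tensor_assoc t))"
  proof (rule triple)
    show "clinear (\<lambda>t. tensor_assoc (opH (tensor_module q ?AB C) t))"
      by (rule clinear_compose[OF clinear_tensor_assoc clinear_opH_tensor[OF hAB hC]])
    show "clinear (\<lambda>t. opH (tensor_module q A ?BC) (tensor_assoc t))"
      by (rule clinear_compose[OF clinear_opH_tensor[OF hA hBC] clinear_tensor_assoc])
    fix x y z
    show "tensor_assoc (opH (tensor_module q ?AB C) ((x \<otimes> y) \<otimes> z))
        = opH (tensor_module q A ?BC) (tensor_assoc ((x \<otimes> y) \<otimes> z))"
      by (simp only: opH_tens[OF hAB hC] opH_tens[OF hA hB] opH_tens[OF hA hBC] opH_tens[OF hB hC]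
          tens_add_left tens_add_right clinear_add[OF clinear_tensor_assoc] tensor_assoc_tens
          add.assoc)
  qed
  note E = coprod[OF clinear_opE[OF A] clinear_opE[OF B] clinear_opE[OF C], THEN fun_cong]
    and F = coprod[OF clinear_opF[OF A] clinear_opF[OF B] clinear_opF[OF C], THEN fun_cong]
  show ?thesis
    unfolding intertwining_def opE_tensor opF_tensor
    using clinear_tensor_assoc E F fun_cong[OF H] by (intro conjI allI)
qed

section \<open>Coordinates with respect to the Verma basis\<close>

definition vcoef :: "nat \<Rightarrow> (verma_space, 'u::complex_vector) tensor \<Rightarrow> 'u"
  where "vcoef k = tensor_lift (\<lambda>p u. Poly_Mapping.lookup p k *\<^sub>C u)"

lemma clinear_vcoef: "clinear (vcoef k)"
  by (simp add: vcoef_def clinear_tensor_lift)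

lemma vcoef_tens: "vcoef k (p \<otimes> u) = Poly_Mapping.lookup p k *\<^sub>C u"
  unfolding vcoef_def
  by (rule tensor_lift_tens)
    (simp add: cbilinear_def clinear_iff lookup_add lookup_scaleC scaleC_complex_def
      cvec.scale_left_distrib cvec.scale_right_distrib mult.commute)

lemma vcoef_fx: "vcoef k (fx j \<otimes> u) = (if j = k then u else 0)"
  by (simp add: vcoef_tens fx_def lookup_single when_def)

lemma vcoef_sum:
  assumes "finite A"
  shows "vcoef k (\<Sum>j\<in>A. fx j \<otimes> g j) = (if k \<in> A then g k else 0)"
proof -
  have "vcoef k (\<Sum>j\<in>A. fx j \<otimes> g j) = (\<Sum>j\<in>A. if j = k then g j else 0)"
    by (simp only: clinear_sum[OF clinear_vcoef] vcoef_fx)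
  also have "\<dots> = (if k \<in> A then g k else 0)"
    using assms by (simp add: sum.delta)
  finally show ?thesis .
qed

lemma vcoef_expansion: "\<exists>N. \<forall>M\<ge>N. t = (\<Sum>k<M. fx k \<otimes> vcoef k t)"
proof (induction t rule: tensor_induct)
  case (tens p u)
  obtain N where N: "\<forall>k\<in>Poly_Mapping.keys p. k < N"
    using finite_nat_set_iff_bounded[THEN iffD1, OF finite_keys] by blast
  have "p \<otimes> u = (\<Sum>k<M. fx k \<otimes> vcoef k (p \<otimes> u))" if "M \<ge> N" for M
  proof -
    have "p = free_ext (\<lambda>k. Poly_Mapping.single k 1) p"
      by (simp only: free_ext_single_id)
    also have "\<dots> = (\<Sum>k<M. Poly_Mapping.lookup p k *\<^sub>C fx k)"
      unfolding fx_def by (rule free_ext_superset) (use N that in auto)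
    finally have "p \<otimes> u = (\<Sum>k<M. Poly_Mapping.lookup p k *\<^sub>C fx k) \<otimes> u"
      by (rule arg_cong)
    also have "\<dots> = (\<Sum>k<M. fx k \<otimes> vcoef k (p \<otimes> u))"
      by (simp only: clinear_sum[OF clinear_tens_left] vcoef_tens tens_scale_left tens_scale_right)
    finally show ?thesis .
  qed
  then show ?case by blast
next
  case (add s t)
  then obtain N L where N: "\<And>M. M \<ge> N \<Longrightarrow> s = (\<Sum>k<M. fx k \<otimes> vcoef k s)"
    and L: "\<And>M. M \<ge> L \<Longrightarrow> t = (\<Sum>k<M. fx k \<otimes> vcoef k t)" by blast
  have "s + t = (\<Sum>k<M. fx k \<otimes> vcoef k (s + t))" if "M \<ge> max N L" for M
  proof -
    have "(\<Sum>k<M. fx k \<otimes> vcoef k (s + t))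
        = (\<Sum>k<M. fx k \<otimes> vcoef k s) + (\<Sum>k<M. fx k \<otimes> vcoef k t)"
      by (simp only: clinear_add[OF clinear_vcoef] tens_add_right sum.distrib)
    also have "\<dots> = s + t"
      using N[of M] L[of M] that by simp
    finally show ?thesis ..
  qed
  then show ?case by blast
qed

lemma vcoef_eqI:
  assumes "\<And>k. vcoef k s = vcoef k t"
  shows "s = t"
proof -
  obtain N where N: "\<forall>M\<ge>N. s = (\<Sum>k<M. fx k \<otimes> vcoef k s)" using vcoef_expansion by blast
  obtain L where L: "\<forall>M\<ge>L. t = (\<Sum>k<M. fx k \<otimes> vcoef k t)" using vcoef_expansion by blast
  have "s = (\<Sum>k<max N L. fx k \<otimes> vcoef k s)" by (rule N[rule_format]) simp
  also have "\<dots> = (\<Sum>k<max N L. fx k \<otimes> vcoef k t)" by (simp only: assms)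
  also have "\<dots> = t" by (rule L[rule_format, symmetric]) simp
  finally show ?thesis .
qed

lemma finite_vcoef: "finite {k. vcoef k t \<noteq> 0}"
proof -
  obtain N where "\<forall>M\<ge>N. t = (\<Sum>k<M. fx k \<otimes> vcoef k t)" using vcoef_expansion by blast
  then have t: "t = (\<Sum>k<N. fx k \<otimes> vcoef k t)" by blast
  have "vcoef k t = 0" if "k \<notin> {..<N}" for k
    by (subst t) (simp only: vcoef_sum[OF finite_lessThan] that if_False)
  then have "{k. vcoef k t \<noteq> 0} \<subseteq> {..<N}" by blast
  then show ?thesis by (rule finite_subset) simp
qed

lemma has_leading_vector_iff: "has_leading_vector t u \<longleftrightarrow> vcoef 0 t = u"
proof
  assume "has_leading_vector t u"
  then obtain uk where t: "t = (\<Sum>k\<in>Poly_Mapping.keys uk. fx k \<otimes> Poly_Mapping.lookup uk k)"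
    and u: "Poly_Mapping.lookup uk 0 = u"
    unfolding has_leading_vector_def by blast
  show "vcoef 0 t = u"
    unfolding t by (simp add: vcoef_sum u in_keys_iff)
next
  assume u: "vcoef 0 t = u"
  define uk where "uk = Abs_poly_mapping (\<lambda>k. vcoef k t)"
  have uk: "Poly_Mapping.lookup uk k = vcoef k t" for k
    unfolding uk_def by (simp add: lookup_Abs_poly_mapping finite_vcoef)
  have "t = (\<Sum>k\<in>Poly_Mapping.keys uk. fx k \<otimes> Poly_Mapping.lookup uk k)"
    by (rule vcoef_eqI) (simp add: vcoef_sum in_keys_iff uk)
  with u uk show "has_leading_vector t u"
    unfolding has_leading_vector_def by blast
qed

lemma verma_tensor_eqI:
  fixes f g :: "(verma_space, 'u::complex_vector) tensor \<Rightarrow> 'a::complex_vector"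
  assumes lin: "clinear f" "clinear g" and eq: "\<And>k u. f (fx k \<otimes> u) = g (fx k \<otimes> u)"
  shows "f = g"
proof (rule clinear_tensor_eqI[OF lin])
  fix p :: verma_space and u :: 'u
  have "(\<lambda>p. f (p \<otimes> u)) = (\<lambda>p. g (p \<otimes> u))"
    by (rule clinear_free_eqI[OF clinear_compose[OF lin(1) clinear_tens_left]
          clinear_compose[OF lin(2) clinear_tens_left]]) (rule eq[unfolded fx_def])
  then show "f (p \<otimes> u) = g (p \<otimes> u)" by (rule fun_cong)
qed

context
  fixes q :: real and U :: "('u::complex_vector) uq_ops" and \<mu> :: complex
  assumes q: "0 < q" "q < 1" and U: "uq_module q U"
begin

private lemmas M = uq_module_verma[OF q, of \<mu>]
private lemmas sM = uq_module_weight_spanned[OF M]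
private lemmas sU = uq_module_weight_spanned[OF U]
private lemmas MU = uq_module_tensor[OF M U]

lemma vcoef_opE:
  "vcoef k (opE (tensor_module q (verma q \<mu>) U) t)
   = (qnum q (of_nat (Suc k)) * qnum q (\<mu> - of_nat k))
       *\<^sub>C fun_h U (\<lambda>z. qpow q (z / 4)) (vcoef (Suc k) t)
     + qpow q (- (\<mu> - 2 * of_nat k) / 4) *\<^sub>C opE U (vcoef k t)"
proof -
  note cE = clinear_opE[OF M] clinear_opE[OF U]
  note lin = clinear_fun_h[OF sU, of "\<lambda>z. qpow q (z / 4)"]
  have "(\<lambda>t. vcoef k (opE (tensor_module q (verma q \<mu>) U) t))
    = (\<lambda>t. (qnum q (of_nat (Suc k)) * qnum q (\<mu> - of_nat k))
         *\<^sub>C fun_h U (\<lambda>z. qpow q (z / 4)) (vcoef (Suc k) t)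
       + qpow q (- (\<mu> - 2 * of_nat k) / 4) *\<^sub>C opE U (vcoef k t))"
  proof (rule verma_tensor_eqI)
    show "clinear (\<lambda>t. vcoef k (opE (tensor_module q (verma q \<mu>) U) t))"
      by (rule clinear_compose[OF clinear_vcoef clinear_opE[OF MU]])
    show "clinear (\<lambda>t. (qnum q (of_nat (Suc k)) * qnum q (\<mu> - of_nat k))
         *\<^sub>C fun_h U (\<lambda>z. qpow q (z / 4)) (vcoef (Suc k) t)
       + qpow q (- (\<mu> - 2 * of_nat k) / 4) *\<^sub>C opE U (vcoef k t))"
      by (rule clinear_plus[OF clinear_scaleC[OF clinear_compose[OF lin clinear_vcoef]]
            clinear_scaleC[OF clinear_compose[OF cE(2) clinear_vcoef]]])
    fix j u
    have "opE (tensor_module q (verma q \<mu>) U) (fx j \<otimes> u)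
        = (qnum q (of_nat j) * qnum q (\<mu> - of_nat j + 1))
            *\<^sub>C (fx (j - 1) \<otimes> fun_h U (\<lambda>z. qpow q (z / 4)) u)
          + qpow q (- (\<mu> - 2 * of_nat j) / 4) *\<^sub>C (fx j \<otimes> opE U u)"
      by (simp only: opE_tensor coprod_tens[OF sM sU cE] opE_verma fun_h_weight[OF sM fx_weight]
          tens_scale_left)
    then have "vcoef k (opE (tensor_module q (verma q \<mu>) U) (fx j \<otimes> u))
        = (qnum q (of_nat j) * qnum q (\<mu> - of_nat j + 1))
            *\<^sub>C (if j - 1 = k then fun_h U (\<lambda>z. qpow q (z / 4)) u else 0)
          + qpow q (- (\<mu> - 2 * of_nat j) / 4) *\<^sub>C (if j = k then opE U u else 0)"
      by (simp only: clinear_add[OF clinear_vcoef] clinear_scale[OF clinear_vcoef] vcoef_fx)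
    also have "\<dots> = (qnum q (of_nat (Suc k)) * qnum q (\<mu> - of_nat k))
            *\<^sub>C (if j = Suc k then fun_h U (\<lambda>z. qpow q (z / 4)) u else 0)
          + qpow q (- (\<mu> - 2 * of_nat k) / 4) *\<^sub>C (if j = k then opE U u else 0)"
      by (cases j) auto
    also have "\<dots> = (qnum q (of_nat (Suc k)) * qnum q (\<mu> - of_nat k))
         *\<^sub>C fun_h U (\<lambda>z. qpow q (z / 4)) (vcoef (Suc k) (fx j \<otimes> u))
       + qpow q (- (\<mu> - 2 * of_nat k) / 4) *\<^sub>C opE U (vcoef k (fx j \<otimes> u))"
      by (simp add: vcoef_fx clinear_0[OF lin] clinear_0[OF cE(2)])
    finally show "vcoef k (opE (tensor_module q (verma q \<mu>) U) (fx j \<otimes> u))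
      = (qnum q (of_nat (Suc k)) * qnum q (\<mu> - of_nat k))
         *\<^sub>C fun_h U (\<lambda>z. qpow q (z / 4)) (vcoef (Suc k) (fx j \<otimes> u))
       + qpow q (- (\<mu> - 2 * of_nat k) / 4) *\<^sub>C opE U (vcoef k (fx j \<otimes> u))" .
  qed
  then show ?thesis by (rule fun_cong)
qed

lemma vcoef_0_opF:
  "vcoef 0 (opF (tensor_module q (verma q \<mu>) U) t) = qpow q (- \<mu> / 4) *\<^sub>C opF U (vcoef 0 t)"
proof -
  note cF = clinear_opF[OF M] clinear_opF[OF U]
  have "(\<lambda>t. vcoef 0 (opF (tensor_module q (verma q \<mu>) U) t))
    = (\<lambda>t. qpow q (- \<mu> / 4) *\<^sub>C opF U (vcoef 0 t))"
  proof (rule verma_tensor_eqI)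
    show "clinear (\<lambda>t. vcoef 0 (opF (tensor_module q (verma q \<mu>) U) t))"
      by (rule clinear_compose[OF clinear_vcoef clinear_opF[OF MU]])
    show "clinear (\<lambda>t. qpow q (- \<mu> / 4) *\<^sub>C opF U (vcoef 0 t))"
      by (rule clinear_scaleC[OF clinear_compose[OF cF(2) clinear_vcoef]])
    fix j u
    have "opF (tensor_module q (verma q \<mu>) U) (fx j \<otimes> u)
        = fx (Suc j) \<otimes> fun_h U (\<lambda>z. qpow q (z / 4)) u
          + qpow q (- (\<mu> - 2 * of_nat j) / 4) *\<^sub>C (fx j \<otimes> opF U u)"
      by (simp only: opF_tensor coprod_tens[OF sM sU cF] opF_verma fun_h_weight[OF sM fx_weight]
          tens_scale_left)
    then have "vcoef 0 (opF (tensor_module q (verma q \<mu>) U) (fx j \<otimes> u))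
        = qpow q (- (\<mu> - 2 * of_nat j) / 4) *\<^sub>C (if j = 0 then opF U u else 0)"
      by (simp add: clinear_add[OF clinear_vcoef] clinear_scale[OF clinear_vcoef] vcoef_fx)
    then show "vcoef 0 (opF (tensor_module q (verma q \<mu>) U) (fx j \<otimes> u))
        = qpow q (- \<mu> / 4) *\<^sub>C opF U (vcoef 0 (fx j \<otimes> u))"
      by (simp add: vcoef_fx clinear_0[OF cF(2)])
  qed
  then show ?thesis by (rule fun_cong)
qed

lemma vcoef_0_opF_funpow:
  "vcoef 0 ((opF (tensor_module q (verma q \<mu>) U) ^^ n) t)
   = qpow q (- \<mu> / 4) ^ n *\<^sub>C (opF U ^^ n) (vcoef 0 t)"
  by (induction n) (simp_all add: vcoef_0_opF clinear_scale[OF clinear_opF[OF U]])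

lemma singular_vector_eq_0:
  assumes gen: "generic q \<mu>" and sing: "opE (tensor_module q (verma q \<mu>) U) t = 0"
    and "vcoef 0 t = 0"
  shows "t = 0"
proof (rule vcoef_eqI)
  let ?K = "fun_h U (\<lambda>z. qpow q (z / 4))" and ?K' = "fun_h U (\<lambda>z. qpow q (- z / 4))"
  have "(\<lambda>x. ?K' (?K x)) = (\<lambda>x. x)"
  proof (rule weight_spanned_eqI[OF sU])
    show "?K' (?K x) = x" if "x \<in> weight_space U \<nu>" for x \<nu>
      by (simp add: fun_h_weight[OF sU that] clinear_scale[OF clinear_fun_h[OF sU]]
          flip: qpow_add)
  qed (rule clinear_compose[OF clinear_fun_h[OF sU] clinear_fun_h[OF sU]] clinear_id)+
  then have inv: "?K' (?K x) = x" for x by (rule fun_cong)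
  have inj: "x = 0" if "?K x = 0" for x
    using inv[of x] that by (simp add: clinear_0[OF clinear_fun_h[OF sU]])
  have "vcoef k t = 0" for k
  proof (induction k)
    case (Suc k)
    have "(qnum q (of_nat (Suc k)) * qnum q (\<mu> - of_nat k)) *\<^sub>C ?K (vcoef (Suc k) t) = 0"
      using vcoef_opE[of k t] Suc
      by (simp add: sing clinear_0[OF clinear_vcoef] clinear_0[OF clinear_opE[OF U]])
    then show ?case
      using qnum_of_nat_nonzero[OF q, of "Suc k"] generic_qnum_nonzero[OF q gen, of k]
      by (simp add: inj)
  qed (rule assms)
  then show "vcoef k t = vcoef k 0" for k
    by (simp add: clinear_0[OF clinear_vcoef])
qed

end

section \<open>The intertwining maps\<close>

lemma intertwining_verma_fx:
  assumes "intertwining (verma q \<Lambda>) X \<Phi>"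
  shows "\<Phi> (fx k) = (opF X ^^ k) (\<Phi> (fx 0))"
proof (induction k)
  case (Suc k)
  have "\<Phi> (fx (Suc k)) = \<Phi> (opF (verma q \<Lambda>) (fx k))" by (simp only: opF_verma)
  also have "\<dots> = opF X (\<Phi> (fx k))" by (rule intertwiningD(3)[OF assms])
  finally show ?case using Suc by simp
qed simp

lemma intertwining_verma_unique:
  assumes q: "0 < q" "q < 1" and U: "uq_module q U" and gen: "generic q \<mu>"
    and \<Phi>: "intertwining (verma q \<Lambda>) (tensor_module q (verma q \<mu>) U) \<Phi>"
    and \<Psi>: "intertwining (verma q \<Lambda>) (tensor_module q (verma q \<mu>) U) \<Psi>"
    and eq: "vcoef 0 (\<Phi> (fx 0)) = vcoef 0 (\<Psi> (fx 0))"
  shows "\<Phi> = \<Psi>"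
proof -
  let ?X = "tensor_module q (verma q \<mu>) U"
  note X = uq_module_tensor[OF uq_module_verma[OF q] U]
  have sing: "opE ?X (\<Theta> (fx 0)) = 0" if "intertwining (verma q \<Lambda>) ?X \<Theta>" for \<Theta>
  proof -
    have "opE ?X (\<Theta> (fx 0)) = \<Theta> (opE (verma q \<Lambda>) (fx 0))"
      by (rule intertwiningD(2)[OF that, symmetric])
    then show ?thesis by (simp add: opE_verma clinear_0[OF intertwiningD(1)[OF that]])
  qed
  have "\<Phi> (fx 0) - \<Psi> (fx 0) = 0"
    by (rule singular_vector_eq_0[OF q U gen])
      (simp_all add: clinear_diff[OF clinear_opE[OF X]] sing[OF \<Phi>] sing[OF \<Psi>]
        clinear_diff[OF clinear_vcoef] eq)
  then have 0: "\<Phi> (fx 0) = \<Psi> (fx 0)" by simp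
  show ?thesis
  proof (rule clinear_free_eqI[OF intertwiningD(1)[OF \<Phi>] intertwiningD(1)[OF \<Psi>]])
    fix k
    have "\<Phi> (fx k) = \<Psi> (fx k)"
      using intertwining_verma_fx[OF \<Phi>, of k] intertwining_verma_fx[OF \<Psi>, of k]
      unfolding 0 by (rule trans[OF _ sym])
    then show "\<Phi> (Poly_Mapping.single k 1) = \<Psi> (Poly_Mapping.single k 1)"
      by (simp only: fx_def)
  qed
qed

lemma singular_vector_intertwining:
  assumes q: "0 < q" "q < 1" and X: "uq_module q X"
    and E: "opE X t = 0" and H: "t \<in> weight_space X \<Lambda>"
  shows "\<exists>\<Phi>. intertwining (verma q \<Lambda>) X \<Phi> \<and> \<Phi> (fx 0) = t"
proof -
  let ?M = "verma q \<Lambda>" and ?\<Phi> = "free_ext (\<lambda>k. (opF X ^^ k) t)"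
  note cM = clinear_opE[OF uq_module_verma[OF q]] clinear_opF[OF uq_module_verma[OF q]]
    clinear_opH[OF uq_module_verma[OF q]]
  note lin = clinear_free_ext[of "\<lambda>k. (opF X ^^ k) t"]
  have \<Phi>: "?\<Phi> (fx k) = (opF X ^^ k) t" for k
    by (simp add: fx_def free_ext_single)
  note wt = opF_funpow_weight[OF X H]
  have E': "opE X ((opF X ^^ k) t)
      = (qnum q (of_nat k) * qnum q (\<Lambda> - of_nat k + 1)) *\<^sub>C (opF X ^^ (k - 1)) t" for k
  proof (induction k)
    case 0
    show ?case by (simp add: E)
  next
    case (Suc k)
    have "opE X ((opF X ^^ Suc k) t)
        = opF X (opE X ((opF X ^^ k) t)) + qnum q (\<Lambda> - 2 * of_nat k) *\<^sub>C (opF X ^^ k) t"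
      using opE_opF[OF X wt[of k]] by (simp add: algebra_simps)
    also have "opF X (opE X ((opF X ^^ k) t))
        = (qnum q (of_nat k) * qnum q (\<Lambda> - of_nat k + 1)) *\<^sub>C (opF X ^^ k) t"
      unfolding Suc.IH clinear_scale[OF clinear_opF[OF X]] by (cases k) simp_all
    finally have "opE X ((opF X ^^ Suc k) t) = (qnum q (of_nat k) * qnum q (\<Lambda> - of_nat k + 1)
        + qnum q (\<Lambda> - of_nat k - of_nat k)) *\<^sub>C (opF X ^^ k) t"
      by (simp add: cvec.scale_left_distrib)
    moreover have "qnum q (of_nat k) * qnum q (\<Lambda> - of_nat k + 1)
        + qnum q (\<Lambda> - of_nat k - of_nat k) = qnum q (of_nat k + 1) * qnum q (\<Lambda> - of_nat k)"
      unfolding qnum_mult_Suc_diff[OF q, symmetric] by simp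
    ultimately show ?case
      by (simp add: add.commute)
  qed
  have eqI: "?\<Phi> (S p) = R (?\<Phi> p)"
    if "clinear S" "clinear R" "\<And>k. ?\<Phi> (S (fx k)) = R (?\<Phi> (fx k))" for S R p
  proof -
    have "(\<lambda>p. ?\<Phi> (S p)) = (\<lambda>p. R (?\<Phi> p))"
      by (rule clinear_free_eqI[OF clinear_compose[OF lin that(1)] clinear_compose[OF that(2) lin]])
        (rule that(3)[unfolded fx_def])
    then show ?thesis by (rule fun_cong)
  qed
  have "?\<Phi> (opE ?M p) = opE X (?\<Phi> p)" for p
    by (rule eqI[OF cM(1) clinear_opE[OF X]])
      (simp only: opE_verma clinear_scale[OF lin] \<Phi> E')
  moreover have "?\<Phi> (opF ?M p) = opF X (?\<Phi> p)" for p
    by (rule eqI[OF cM(2) clinear_opF[OF X]]) (simp add: opF_verma \<Phi>)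
  moreover have "?\<Phi> (opH ?M p) = opH X (?\<Phi> p)" for p
    by (rule eqI[OF cM(3) clinear_opH[OF X]])
      (simp only: opH_verma clinear_scale[OF lin] \<Phi> wt[unfolded weight_space_iff])
  ultimately have "intertwining ?M X ?\<Phi>"
    unfolding intertwining_def using lin by blast
  then show ?thesis using \<Phi>[of 0] by (intro exI[of _ ?\<Phi>]) simp
qed

definition phi_coef :: "real \<Rightarrow> complex \<Rightarrow> complex \<Rightarrow> nat \<Rightarrow> complex"
  where "phi_coef q \<Lambda> \<nu> k =
    qpow q (- (of_nat k * (\<Lambda> + 2)) / 4) / (qfact q k * qpoch q (- \<Lambda> + \<nu>) k)"

lemma phi_coef_Suc:
  assumes q: "0 < q" "q < 1" and gen: "generic q (\<Lambda> - \<nu>)"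
  shows "qnum q (of_nat (Suc k)) * qnum q (\<Lambda> - \<nu> - of_nat k) * phi_coef q \<Lambda> \<nu> (Suc k)
      * qpow q ((\<nu> + 2 * of_nat (Suc k)) / 4)
    = - (qpow q (- (\<Lambda> - \<nu> - 2 * of_nat k) / 4) * phi_coef q \<Lambda> \<nu> k)"
proof -
  let ?a = "qnum q (of_nat (Suc k))" and ?b = "qnum q (\<Lambda> - \<nu> - of_nat k)"
  have nz: "?a \<noteq> 0" "?b \<noteq> 0"
    using qnum_of_nat_nonzero[OF q, of "Suc k"] generic_qnum_nonzero[OF q gen, of k] by simp_all
  have "qnum q (- \<Lambda> + \<nu> + of_nat k) = - ?b"
    using qnum_minus[of q "\<Lambda> - \<nu> - of_nat k"] by (simp add: algebra_simps)
  then have "qpoch q (- \<Lambda> + \<nu>) (Suc k) = qpoch q (- \<Lambda> + \<nu>) k * - ?b"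
    by (simp add: qpoch_def)
  moreover have "qfact q (Suc k) = qfact q k * ?a"
    by (simp add: qfact_def)
  moreover have "qpow q (- (of_nat (Suc k) * (\<Lambda> + 2)) / 4)
      = qpow q (- (of_nat k * (\<Lambda> + 2)) / 4) * qpow q (- (\<Lambda> + 2) / 4)"
    by (simp add: algebra_simps diff_divide_distrib add_divide_distrib flip: qpow_add)
  ultimately have "phi_coef q \<Lambda> \<nu> (Suc k)
      = - (phi_coef q \<Lambda> \<nu> k * qpow q (- (\<Lambda> + 2) / 4) / (?a * ?b))"
    by (simp add: phi_coef_def mult_ac)
  then have "?a * ?b * phi_coef q \<Lambda> \<nu> (Suc k) = - (phi_coef q \<Lambda> \<nu> k * qpow q (- (\<Lambda> + 2) / 4))"
    using nz by simp
  then have "?a * ?b * phi_coef q \<Lambda> \<nu> (Suc k) * qpow q ((\<nu> + 2 * of_nat (Suc k)) / 4)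
      = - (phi_coef q \<Lambda> \<nu> k * qpow q (- (\<Lambda> + 2) / 4)) * qpow q ((\<nu> + 2 * of_nat (Suc k)) / 4)"
    by (rule arg_cong)
  also have "\<dots> = - (qpow q (- (\<Lambda> + 2) / 4) * qpow q ((\<nu> + 2 * of_nat (Suc k)) / 4)
      * phi_coef q \<Lambda> \<nu> k)"
    by simp
  also have "qpow q (- (\<Lambda> + 2) / 4) * qpow q ((\<nu> + 2 * of_nat (Suc k)) / 4)
      = qpow q (- (\<Lambda> - \<nu> - 2 * of_nat k) / 4)"
    by (simp add: algebra_simps diff_divide_distrib add_divide_distrib flip: qpow_add)
  finally show ?thesis .
qed

lemma Phi_exists:
  assumes q: "0 < q" "q < 1" and U: "uq_module q U" and u: "u \<in> weight_space U \<nu>"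
    and gen: "generic q (\<Lambda> - \<nu>)"
  shows "\<exists>\<Phi>. intertwining (verma q \<Lambda>) (tensor_module q (verma q (\<Lambda> - \<nu>)) U) \<Phi>
    \<and> (\<forall>k. vcoef k (\<Phi> (fx 0)) = phi_coef q \<Lambda> \<nu> k *\<^sub>C (opE U ^^ k) u)"
proof -
  let ?M = "verma q (\<Lambda> - \<nu>)"
  let ?X = "tensor_module q ?M U"
  note M = uq_module_verma[OF q, of "\<Lambda> - \<nu>"]
  note X = uq_module_tensor[OF M U]
  note sU = uq_module_weight_spanned[OF U]
  obtain N where N: "\<And>n. n \<ge> N \<Longrightarrow> (opE U ^^ n) u = 0"
    using opE_nilpotent[OF U u] by blast
  define t where "t = (\<Sum>k<N. fx k \<otimes> (phi_coef q \<Lambda> \<nu> k *\<^sub>C (opE U ^^ k) u))"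
  have vc: "vcoef k t = phi_coef q \<Lambda> \<nu> k *\<^sub>C (opE U ^^ k) u" for k
    unfolding t_def vcoef_sum[OF finite_lessThan] using N[of k] by auto
  note wt = opE_funpow_weight[OF U u]
  have wX: "fx k \<otimes> (opE U ^^ k) u \<in> weight_space ?X \<Lambda>" for k
    using tens_weight[OF clinear_opH[OF M] clinear_opH[OF U] fx_weight[of k q] wt[of k]] by simp
  have "t \<in> weight_space ?X \<Lambda>"
    unfolding t_def tens_scale_right
    by (intro cvec.subspace_sum cvec.subspace_scale subspace_weight_space clinear_opH[OF X] wX)
  moreover have "opE ?X t = 0"
  proof (rule vcoef_eqI)
    fix k
    have "vcoef k (opE ?X t) = (qnum q (of_nat (Suc k)) * qnum q (\<Lambda> - \<nu> - of_nat k)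
          * phi_coef q \<Lambda> \<nu> (Suc k) * qpow q ((\<nu> + 2 * of_nat (Suc k)) / 4)
        + qpow q (- (\<Lambda> - \<nu> - 2 * of_nat k) / 4) * phi_coef q \<Lambda> \<nu> k) *\<^sub>C (opE U ^^ Suc k) u"
      unfolding vcoef_opE[OF q U] vc clinear_scale[OF clinear_fun_h[OF sU]]
        clinear_scale[OF clinear_opE[OF U]] fun_h_weight[OF sU wt]
      by (simp only: scaleC_scaleC cvec.scale_left_distrib funpow.simps comp_apply mult.assoc)
    then show "vcoef k (opE ?X t) = vcoef k 0"
      by (simp add: phi_coef_Suc[OF q gen] clinear_0[OF clinear_vcoef] del: of_nat_Suc)
  qed
  ultimately obtain \<Phi> where "intertwining (verma q \<Lambda>) ?X \<Phi>" "\<Phi> (fx 0) = t"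
    using singular_vector_intertwining[OF q X] by blast
  with vc show ?thesis by (intro exI[of _ \<Phi>]) simp
qed

lemma
  assumes q: "0 < q" "q < 1" and U: "uq_module q U" and u: "u \<in> weight_space U \<nu>" "u \<noteq> 0"
    and gen: "generic q (\<Lambda> - \<nu>)"
  shows intertwining_Phi:
      "intertwining (verma q \<Lambda>) (tensor_module q (verma q (\<Lambda> - \<nu>)) U) (Phi q U \<Lambda> u)"
    and vcoef_Phi: "vcoef k (Phi q U \<Lambda> u (fx 0)) = phi_coef q \<Lambda> \<nu> k *\<^sub>C (opE U ^^ k) u"
    and Phi_eqI: "intertwining (verma q \<Lambda>) (tensor_module q (verma q (\<Lambda> - \<nu>)) U) \<Psi>
      \<Longrightarrow> vcoef 0 (\<Psi> (fx 0)) = u \<Longrightarrow> \<Psi> = Phi q U \<Lambda> u"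
proof -
  let ?X = "tensor_module q (verma q (\<Lambda> - \<nu>)) U"
  obtain \<Phi> where \<Phi>: "intertwining (verma q \<Lambda>) ?X \<Phi>"
    and c: "\<And>k. vcoef k (\<Phi> (fx 0)) = phi_coef q \<Lambda> \<nu> k *\<^sub>C (opE U ^^ k) u"
    using Phi_exists[OF q U u(1) gen] by blast
  have c0: "vcoef 0 (\<Phi> (fx 0)) = u"
    using c[of 0] by (simp add: phi_coef_def qfact_def qpoch_def)
  have unique: "\<Psi> = \<Phi>" if "intertwining (verma q \<Lambda>) ?X \<Psi>" "vcoef 0 (\<Psi> (fx 0)) = u" for \<Psi>
    by (rule intertwining_verma_unique[OF q U gen that(1) \<Phi>]) (simp only: that(2) c0)
  have "Phi q U \<Lambda> u = \<Phi>"
    unfolding Phi_def wt_eqI[OF u] has_leading_vector_iff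
    by (rule the_equality, rule conjI[OF \<Phi> c0], elim conjE, rule unique)
  then show "intertwining (verma q \<Lambda>) ?X (Phi q U \<Lambda> u)"
    "vcoef k (Phi q U \<Lambda> u (fx 0)) = phi_coef q \<Lambda> \<nu> k *\<^sub>C (opE U ^^ k) u"
    "intertwining (verma q \<Lambda>) ?X \<Psi> \<Longrightarrow> vcoef 0 (\<Psi> (fx 0)) = u \<Longrightarrow> \<Psi> = Phi q U \<Lambda> u"
    using \<Phi> c unique by simp_all
qed

section \<open>The fusion matrix\<close>

lemma cbilinear_Sum_any:
  assumes B: "\<And>l. cbilinear (B l)" and fin: "\<And>x y. finite {l. B l x y \<noteq> 0}"
  shows "cbilinear (\<lambda>x y. Sum_any (\<lambda>l. B l x y))"
proof -
  have scale: "Sum_any (\<lambda>l. c *\<^sub>C B l x y) = c *\<^sub>C Sum_any (\<lambda>l. B l x y)" for c x y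
  proof -
    let ?A = "{l. B l x y \<noteq> 0}"
    have "Sum_any (\<lambda>l. c *\<^sub>C B l x y) = (\<Sum>l\<in>?A. c *\<^sub>C B l x y)"
      by (rule Sum_any.expand_superset[OF fin]) auto
    then show ?thesis
      by (simp only: Sum_any.expand_set cvec.scale_sum_right)
  qed
  show ?thesis
    by (intro cbilinearI clinearI)
      (simp_all only: cbilinearD[OF B] scale Sum_any.distrib[OF fin fin])
qed

lemma cbilinear_fusion_term:
  assumes V: "uq_module q V" and W: "uq_module q W"
  shows "cbilinear (\<lambda>w v. fusion_term q W V \<Lambda> w v l)"
proof -
  note A = clinear_compose[OF clinear_funpow[OF clinear_opF[OF W]]
      clinear_fun_h[OF uq_module_weight_spanned[OF W]]]
  note B = clinear_compose[OF clinear_funpow[OF clinear_opE[OF V]]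
      clinear_fun_h[OF uq_module_weight_spanned[OF V]]]
  show ?thesis
    unfolding fusion_term_def
    by (rule cbilinearI)
      (rule clinear_scaleC[OF clinear_compose[OF clinear_tens_left A]]
        clinear_scaleC[OF clinear_compose[OF clinear_tens_right B]])+
qed

lemma fusion_term_support:
  assumes "uq_module q V"
  shows "\<exists>N. \<forall>M\<ge>N. {l. fusion_term q W V \<Lambda> w v l \<noteq> 0} \<subseteq> {..<M}"
proof -
  obtain N where N: "\<forall>n\<ge>N. \<forall>g. (opE V ^^ n) (fun_h V g v) = 0"
    using opE_fun_h_nilpotent[OF assms] by blast
  have "l < N" if "fusion_term q W V \<Lambda> w v l \<noteq> 0" for l
  proof (rule ccontr)
    assume "\<not> l < N"
    then have "fusion_term q W V \<Lambda> w v l = 0"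
      using N by (simp add: fusion_term_def)
    with that show False by contradiction
  qed
  then show ?thesis by (intro exI[of _ N]) fastforce
qed

lemma finite_fusion_term:
  assumes "uq_module q V"
  shows "finite {l. fusion_term q W V \<Lambda> w v l \<noteq> 0}"
proof -
  obtain N where N: "\<forall>M\<ge>N. {l. fusion_term q W V \<Lambda> w v l \<noteq> 0} \<subseteq> {..<M}"
    using fusion_term_support[OF assms] by blast
  show ?thesis
    by (rule finite_subset[OF N[rule_format, OF order_refl]]) simp
qed

lemma vcoef_tensor_assoc: "vcoef k (tensor_assoc (s \<otimes> y)) = vcoef k s \<otimes> y"
proof (induction s rule: tensor_induct)
  case (tens a b)
  show ?case by (simp only: tensor_assoc_tens vcoef_tens tens_scale_left)
next
  case (add s t)
  then show ?case
    by (simp only: tens_add_left clinear_add[OF clinear_tensor_assoc] clinear_add[OF clinear_vcoef])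
qed

context
  fixes q :: real and V :: "('v::complex_vector) uq_ops" and W :: "('w::complex_vector) uq_ops"
    and v :: 'v and w :: 'w and \<Lambda> \<nu> \<omega> :: complex
  assumes q: "0 < q" "q < 1" and V: "uq_module q V" and W: "uq_module q W"
    and v: "v \<in> weight_space V \<nu>" "v \<noteq> 0" and w: "w \<in> weight_space W \<omega>" "w \<noteq> 0"
    and gen: "generic q (\<Lambda> - \<nu>)" "generic q (\<Lambda> - \<nu> - \<omega>)"
begin

lemma fusion_term_weight:
  "fusion_term q W V \<Lambda> w v l = (qpow q (- (\<Lambda> - \<nu> - \<omega>) / 4) ^ l * phi_coef q \<Lambda> \<nu> l)
    *\<^sub>C ((opF W ^^ l) w \<otimes> (opE V ^^ l) v)"
proof -
  have "qpow q (- (of_nat l / 2) * (\<Lambda> + 1)) * (qpow q (of_nat l * \<omega> / 4) * qpow q (of_nat l * \<nu> / 4))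
      = qpow q (of_nat l * (- (\<Lambda> - \<nu> - \<omega>) / 4)) * qpow q (- (of_nat l * (\<Lambda> + 2)) / 4)"
    by (simp add: algebra_simps diff_divide_distrib add_divide_distrib flip: qpow_add)
  then have "qpow q (- (of_nat l / 2) * (\<Lambda> + 1)) / qfact q l
        * (qpow q (of_nat l * \<nu> / 4) / qpoch q (- \<Lambda> + \<nu>) l * qpow q (of_nat l * \<omega> / 4))
      = qpow q (- (\<Lambda> - \<nu> - \<omega>) / 4) ^ l * phi_coef q \<Lambda> \<nu> l"
    unfolding qpow_of_nat_mult[of q l "- (\<Lambda> - \<nu> - \<omega>) / 4"] phi_coef_def by (simp add: mult_ac)
  then show ?thesis
    unfolding fusion_term_def fun_h_weight[OF uq_module_weight_spanned[OF V] v(1)]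
      fun_h_weight[OF uq_module_weight_spanned[OF W] w(1)]
      clinear_scale[OF clinear_funpow[OF clinear_opF[OF W]]]
      clinear_scale[OF clinear_funpow[OF clinear_opE[OF V]]]
      tens_scale_left tens_scale_right scaleC_scaleC
    by (simp only: mult.assoc)
qed

lemma fusion_sum_weight_space:
  "Sum_any (fusion_term q W V \<Lambda> w v) \<in> weight_space (tensor_module q W V) (\<nu> + \<omega>)"
proof -
  have "(opF W ^^ l) w \<otimes> (opE V ^^ l) v \<in> weight_space (tensor_module q W V) (\<nu> + \<omega>)" for l
    using tens_weight[OF clinear_opH[OF W] clinear_opH[OF V] opF_funpow_weight[OF W w(1), of l]
        opE_funpow_weight[OF V v(1), of l], of q] by (simp add: add.commute)
  then show ?thesis
    unfolding Sum_any.expand_set fusion_term_weight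
    by (intro cvec.subspace_sum cvec.subspace_scale subspace_weight_space
        clinear_opH[OF uq_module_tensor[OF W V]])
qed

text \<open>The terms with \<open>l > 0\<close> are killed by the projection to the weight space of \<open>w\<close> in the
  first factor.\<close>

lemma fusion_sum_nonzero: "Sum_any (fusion_term q W V \<Lambda> w v) \<noteq> 0"
proof
  assume 0: "Sum_any (fusion_term q W V \<Lambda> w v) = 0"
  let ?\<pi> = "fun_h W (\<lambda>z. if z = \<omega> then 1 else 0)"
  note sW = uq_module_weight_spanned[OF W]
  note lin = clinear_tensor_map[OF clinear_fun_h[OF sW, of "\<lambda>z. if z = \<omega> then 1 else 0"] clinear_id']
  obtain N where N: "\<forall>M\<ge>N. {l. fusion_term q W V \<Lambda> w v l \<noteq> 0} \<subseteq> {..<M}"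
    using fusion_term_support[OF V] by blast
  have \<pi>: "?\<pi> ((opF W ^^ l) w) = (if l = 0 then w else 0)" for l
    by (simp add: fun_h_weight[OF sW opF_funpow_weight[OF W w(1)]])
  have "Sum_any (fusion_term q W V \<Lambda> w v) = (\<Sum>l<Suc N. fusion_term q W V \<Lambda> w v l)"
    by (rule Sum_any.expand_superset[OF finite_lessThan N[rule_format]]) simp
  then have "tensor_map ?\<pi> id 0 = tensor_map ?\<pi> id (\<Sum>l<Suc N. fusion_term q W V \<Lambda> w v l)"
    unfolding 0 by (rule arg_cong)
  also have "\<dots> = (\<Sum>l<Suc N. (qpow q (- (\<Lambda> - \<nu> - \<omega>) / 4) ^ l * phi_coef q \<Lambda> \<nu> l)
      *\<^sub>C ((if l = 0 then w else 0) \<otimes> (opE V ^^ l) v))"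
    by (simp only: clinear_sum[OF lin] fusion_term_weight clinear_scale[OF lin]
        tensor_map_id_tens[OF clinear_fun_h[OF sW]] \<pi>)
  also have "\<dots> = w \<otimes> v"
    by (subst sum.lessThan_Suc_shift) (simp add: phi_coef_def qfact_def qpoch_def)
  finally have "w \<otimes> v = 0"
    unfolding clinear_0[OF lin] ..
  then show False using tens_nonzero[OF w(2) v(2)] by blast
qed

lemma intertwining_composite:
  "intertwining (verma q \<Lambda>) (tensor_module q (verma q (\<Lambda> - \<nu> - \<omega>)) (tensor_module q W V))
    (tensor_assoc \<circ> tensor_map (Phi q W (\<Lambda> - \<nu>) w) id \<circ> Phi q V \<Lambda> v)"
proof -
  note M = uq_module_verma[OF q]
  show ?thesis
    unfolding comp_assoc
    by (rule intertwining_compose[OF intertwining_compose[OF intertwining_Phi[OF q V v gen(1)]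
            intertwining_tensor_map[OF M uq_module_tensor[OF M W] V
              intertwining_Phi[OF q W w gen(2)]]]
          intertwining_tensor_assoc[OF M W V]])
qed

lemma vcoef_0_composite:
  "vcoef 0 ((tensor_assoc \<circ> tensor_map (Phi q W (\<Lambda> - \<nu>) w) id \<circ> Phi q V \<Lambda> v) (fx 0))
    = Sum_any (fusion_term q W V \<Lambda> w v)"
proof -
  let ?\<Phi> = "Phi q W (\<Lambda> - \<nu>) w" and ?t = "Phi q V \<Lambda> v (fx 0)"
  note \<Phi> = intertwining_Phi[OF q W w gen(2)]
  note lin = clinear_tensor_map[OF intertwiningD(1)[OF \<Phi>] clinear_id']
  obtain N where N: "\<forall>M\<ge>N. {l. fusion_term q W V \<Lambda> w v l \<noteq> 0} \<subseteq> {..<M}"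
    using fusion_term_support[OF V] by blast
  obtain L where L: "\<forall>M\<ge>L. ?t = (\<Sum>k<M. fx k \<otimes> vcoef k ?t)"
    using vcoef_expansion by blast
  let ?M = "max N L"
  have "?t = (\<Sum>k<?M. fx k \<otimes> vcoef k ?t)"
    by (rule L[rule_format]) simp
  then have t: "?t = (\<Sum>k<?M. fx k \<otimes> (phi_coef q \<Lambda> \<nu> k *\<^sub>C (opE V ^^ k) v))"
    unfolding vcoef_Phi[OF q V v gen(1)] .
  have vc: "vcoef 0 (?\<Phi> (fx k)) = qpow q (- (\<Lambda> - \<nu> - \<omega>) / 4) ^ k *\<^sub>C (opF W ^^ k) w" for k
  proof -
    have "vcoef 0 (?\<Phi> (fx 0)) = w"
      using vcoef_Phi[OF q W w gen(2), of 0] by (simp add: phi_coef_def qfact_def qpoch_def)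
    then show ?thesis
      unfolding intertwining_verma_fx[OF \<Phi>, of k] vcoef_0_opF_funpow[OF q W] by simp
  qed
  have "vcoef 0 (tensor_assoc (tensor_map ?\<Phi> id ?t))
      = (\<Sum>k<?M. vcoef 0 (?\<Phi> (fx k)) \<otimes> (phi_coef q \<Lambda> \<nu> k *\<^sub>C (opE V ^^ k) v))"
    unfolding t clinear_sum[OF lin] tensor_map_id_tens[OF intertwiningD(1)[OF \<Phi>]]
      clinear_sum[OF clinear_tensor_assoc] clinear_sum[OF clinear_vcoef] vcoef_tensor_assoc ..
  also have "\<dots> = (\<Sum>k<?M. fusion_term q W V \<Lambda> w v k)"
    unfolding fusion_term_weight vc tens_scale_left tens_scale_right scaleC_scaleC
    by (simp only: mult.commute)
  also have "\<dots> = Sum_any (fusion_term q W V \<Lambda> w v)"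
    by (rule Sum_any.expand_superset[OF finite_lessThan N[rule_format], symmetric]) simp
  finally show ?thesis by (simp only: comp_apply)
qed

lemma composite_eq_Phi:
  "tensor_assoc \<circ> tensor_map (Phi q W (\<Lambda> - \<nu>) w) id \<circ> Phi q V \<Lambda> v
    = Phi q (tensor_module q W V) \<Lambda> (Sum_any (fusion_term q W V \<Lambda> w v))"
proof (rule Phi_eqI[OF q uq_module_tensor[OF W V] fusion_sum_weight_space fusion_sum_nonzero])
  show "generic q (\<Lambda> - (\<nu> + \<omega>))"
    using gen(2) by (simp only: diff_diff_eq)
  show "intertwining (verma q \<Lambda>) (tensor_module q (verma q (\<Lambda> - (\<nu> + \<omega>))) (tensor_module q W V))
      (tensor_assoc \<circ> tensor_map (Phi q W (\<Lambda> - \<nu>) w) id \<circ> Phi q V \<Lambda> v)"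
    using intertwining_composite by (simp only: diff_diff_eq)
qed (rule vcoef_0_composite)

lemma fusion_vector_eq: "fusion_vector q W V \<Lambda> w v = Sum_any (fusion_term q W V \<Lambda> w v)"
  unfolding fusion_vector_def wt_eqI[OF v] wt_eqI[OF w]
proof (rule the_equality, intro conjI)
  let ?C = "tensor_assoc \<circ> tensor_map (Phi q W (\<Lambda> - \<nu>) w) id \<circ> Phi q V \<Lambda> v"
  fix u assume u: "u \<noteq> 0 \<and> u \<in> weight_space (tensor_module q W V) (\<nu> + \<omega>)
      \<and> ?C = Phi q (tensor_module q W V) \<Lambda> u"
  have "generic q (\<Lambda> - (\<nu> + \<omega>))"
    using gen(2) by (simp only: diff_diff_eq)
  with u have "vcoef 0 (Phi q (tensor_module q W V) \<Lambda> u (fx 0)) = u"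
    using vcoef_Phi[OF q uq_module_tensor[OF W V], of u "\<nu> + \<omega>" \<Lambda> 0]
    by (simp add: phi_coef_def qfact_def qpoch_def)
  moreover have "?C (fx 0) = Phi q (tensor_module q W V) \<Lambda> u (fx 0)"
    using u by (intro fun_cong[of ?C]) blast
  ultimately show "u = Sum_any (fusion_term q W V \<Lambda> w v)"
    using vcoef_0_composite by (simp only:)
qed (rule fusion_sum_nonzero fusion_sum_weight_space composite_eq_Phi)+

end

lemma fusion_matrix_eq:
  assumes q: "0 < q" "q < 1" and V: "uq_module q V" and W: "uq_module q W"
    and v: "weight_vector V v" and w: "weight_vector W w"
    and gen: "generic q (\<Lambda> - wt V v)" "generic q (\<Lambda> - wt V v - wt W w)"
  shows "fusion_matrix q W V \<Lambda> (w \<otimes> v) = fusion_vector q W V \<Lambda> w v"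
proof -
  let ?P = "\<lambda>J. clinear J \<and> (\<forall>w v. weight_vector W w \<longrightarrow> weight_vector V v
    \<longrightarrow> generic q (\<Lambda> - wt V v) \<longrightarrow> generic q (\<Lambda> - wt V v - wt W w)
    \<longrightarrow> J (w \<otimes> v) = fusion_vector q W V \<Lambda> w v)"
  let ?B = "\<lambda>w v. Sum_any (fusion_term q W V \<Lambda> w v)"
  have B: "cbilinear ?B"
    by (rule cbilinear_Sum_any[OF cbilinear_fusion_term[OF V W] finite_fusion_term[OF V]])
  have "?P (tensor_lift ?B)"
  proof (intro conjI allI impI)
    show "clinear (tensor_lift ?B)" by (rule clinear_tensor_lift)
    fix w v assume wv: "weight_vector W w" "weight_vector V v"
      and gen: "generic q (\<Lambda> - wt V v)" "generic q (\<Lambda> - wt V v - wt W w)"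
    obtain \<nu> where \<nu>: "v \<in> weight_space V \<nu>" "v \<noteq> 0"
      using wv(2) unfolding weight_vector_def by blast
    obtain \<omega> where \<omega>: "w \<in> weight_space W \<omega>" "w \<noteq> 0"
      using wv(1) unfolding weight_vector_def by blast
    show "tensor_lift ?B (w \<otimes> v) = fusion_vector q W V \<Lambda> w v"
      unfolding tensor_lift_tens[OF B]
      by (rule fusion_vector_eq[OF q V W \<nu> \<omega> gen[unfolded wt_eqI[OF \<nu>] wt_eqI[OF \<omega>]], symmetric])
  qed
  then have "?P (fusion_matrix q W V \<Lambda>)"
    unfolding fusion_matrix_def by (rule someI[of ?P])
  then show ?thesis using v w gen by blast
qed

theorem theorem5p1:
  fixes q :: real
    and V :: "('v::complex_vector) uq_ops" and W :: "('w::complex_vector) uq_ops"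
    and v :: 'v and w :: 'w and \<Lambda> :: complex
  assumes "0 < q" and "q < 1"
    and "uq_module q V" and "uq_module q W"
    and "weight_vector V v" and "weight_vector W w"
    and "generic q (\<Lambda> - wt V v)"
    and "generic q (\<Lambda> - wt V v - wt W w)"
  shows "tensor_assoc \<circ> tensor_map (Phi q W (\<Lambda> - wt V v) w) id \<circ> Phi q V \<Lambda> v
           = Phi q (tensor_module q W V) \<Lambda> (fusion_matrix q W V \<Lambda> (w \<otimes> v))
      \<and> finite {l. fusion_term q W V \<Lambda> w v l \<noteq> 0}
      \<and> fusion_matrix q W V \<Lambda> (w \<otimes> v)
           = (\<Sum>l | fusion_term q W V \<Lambda> w v l \<noteq> 0. fusion_term q W V \<Lambda> w v l)"
proof -
  obtain \<nu> where \<nu>: "v \<in> weight_space V \<nu>" "v \<noteq> 0"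
    using assms(5) unfolding weight_vector_def by blast
  obtain \<omega> where \<omega>: "w \<in> weight_space W \<omega>" "w \<noteq> 0"
    using assms(6) unfolding weight_vector_def by blast
  note gen = assms(7,8)[unfolded wt_eqI[OF \<nu>] wt_eqI[OF \<omega>]]
  have J: "fusion_matrix q W V \<Lambda> (w \<otimes> v) = Sum_any (fusion_term q W V \<Lambda> w v)"
    unfolding fusion_matrix_eq[OF assms]
    by (rule fusion_vector_eq[OF assms(1-4) \<nu> \<omega> gen])
  show ?thesis
    unfolding J wt_eqI[OF \<nu>]
    using composite_eq_Phi[OF assms(1-4) \<nu> \<omega> gen] finite_fusion_term[OF assms(3)]
      Sum_any.expand_set[of "fusion_term q W V \<Lambda> w v"]
    by (intro conjI)
qed

end
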